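(* Suppose $\bar\alpha>2$. (1) When $d=1$, write $\alpha=\alpha_1$. Then $Y_1=\{Y_1(u),u\ge0\}$ and $Y_2=\{Y_2(u),u\ge0\}$ are, up to some multiplicative constants, fractional Brownian motions with Hurst indices $H_1=\frac{1+\alpha}{2}$ and $H_2=\frac{1+2\alpha}{2}$, respectively. (2) When $d\ge2$, $Y_1=\{Y_1(u),u\in[0,\infty)^d\}$ and $Y_2=\{Y_2(u),u\in[0,\infty)^d\}$ are operator-scaling Gaussian random fields with exponent $H$, where $H$ is the $d\times d$ diagonal matrix $(1/\alpha_k)_{1\le k\le d}$, and they have non-stationary increments.
   Context: Fix $d\ge1$, $\gamma>0$, $\theta\ge0$, $\alpha_1,\dots,\alpha_d\in(0,2]$ and $\bar\alpha=\sum_{k=1}^d1/\alpha_k$. $\mathcal S(\mathbb R^d)$ is the space of smooth rapidly decreasing functions, $\mathcal S'(\mathbb R^d)$ its dual, and $\widehat\phi(z)=\int_{\mathbb R^d}e^{i\langle x,z\rangle}\phi(x)\,dx$. Let $\bar X_1,\bar X_2$ be independent centered Gaussian $\mathcal S'(\mathbb R^d)$-valued processes (indexed by $t\ge0$) with covariances, for $\phi_1,\phi_2\in\mathcal S(\mathbb R^d)$, $$\mathrm{Cov}(\langle\bar X_1(r),\phi_1\rangle,\langle\bar X_1(t),\phi_2\rangle)=\frac1{(2\pi)^d}\int_{\mathbb R^d}\frac{2}{\sum_{k=1}^d|z_k|^{\alpha_k}}\widehat\phi_1(z)\overline{\widehat\phi_2(z)}\,dz\int_0^{r\wedge t}e^{-\theta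 s}ds,$$ $$\mathrm{Cov}(\langle\bar X_2(r),\phi_1\rangle,\langle\bar X_2(t),\phi_2\rangle)=\frac1{(2\pi)^d}\int_{\mathbb R^d}\frac{\gamma}{(\sum_{k=1}^d|z_k|^{\alpha_k})^2}\widehat\phi_1(z)\overline{\widehat\phi_2(z)}\,dz\int_0^{r\wedge t}e^{-\theta s}ds.$$ For $u=(u_k)_{1\le k\le d}\in[0,\infty)^d$ let $D(u)=\{(x_1,\dots,x_d):0\le x_k\le u_k,\ 1\le k\le d\}$ and $Y_i(u)=\langle\bar X_i(1),\mathbf 1_{D(u)}\rangle$, $i=1,2$, where $\langle\bar X_i(1),\cdot\rangle$ is extended from $\mathcal S(\mathbb R^d)$ to the indicators $\mathbf 1_{D(u)}$; that is, $Y_1$ and $Y_2$ are the centered Gaussian random fields whose covariances $\mathbb E[Y_i(u)Y_i(v)]$ are given by the two formulas above with $r=t=1$, $\phi_1=\mathbf 1_{D(u)}$, $\phi_2=\mathbf 1_{D(v)}$ (the integrals are finite when $\bar\alpha>2$). For a linear operator $E$ on $\mathbb R^d$ and $c>0$, $c^E=\sum_{n=0}^\infty\frac{(\ln c)^nE^n}{n!}$. A random field $Y=\{Y(t)\}$ is called operator-scaling with (time-scaling) exponent $E$, where $E$ is a linear operator on $\mathbb R^d$ whose eigenvalues have positive real parts, if for all constants $c>0$ the fields $\{Y(c^Et)\}_t$ and $\{c\,Y(t)\}_t$ have the same finite-dimensional distributions; here $t$ ranges over $\mathbb R^d$, or over $[0,\infty)^d$ for fields indexed by $[0,\infty)^d$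 (with $E$ diagonal, so that $c^E$ maps $[0,\infty)^d$ to itself). A field $Y$ has stationary increments if the law of its increments $Y(u)-Y(v)$ is invariant under translation of the parameters (that is, for every $h\in[0,\infty)^d$ the fields $\{Y(u+h)-Y(h)\}_u$ and $\{Y(u)-Y(0)\}_u$ have the same finite-dimensional distributions); otherwise it has non-stationary increments. A fractional Brownian motion with Hurst index $h\in(0,1)$ is a centered Gaussian process $B_h$ on $[0,\infty)$ with $\mathbb E(B_h(u)B_h(v))=\frac12(u^{2h}+v^{2h}-|u-v|^{2h})$.
   Formalization: In (2) the exponent H is replaced by (2/(i+ᾱ))H for Y_i, i=1,2: since Y_i(c^H u) has the law of c^{(i+ᾱ)/2}Y_i(u), exponent H itself fails under the stated definition whenever ᾱ>2. *)

theory Defs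
  imports "HOL-Probability.Probability"
begin

section \<open>Random fields\<close>

text \<open>A random field indexed by \<open>T\<close> is a function \<open>Y\<close> whose values \<open>Y t\<close>, for \<open>t \<in> T\<close>, are random
  variables on \<open>M\<close>; the values of \<open>Y\<close> outside \<open>T\<close> are irrelevant. Constants count as (degenerate)
  Gaussian variables.\<close>

definition gaussian_rv :: "'w measure \<Rightarrow> ('w \<Rightarrow> real) \<Rightarrow> bool" where
  "gaussian_rv M X \<longleftrightarrow> X \<in> borel_measurable M \<and>
     ((\<exists>\<mu>. AE \<omega> in M. X \<omega> = \<mu>) \<or>
      (\<exists>\<mu> \<sigma>. \<sigma> > 0 \<and> distributed M lborel X (normal_density \<mu> \<sigma>)))"

definition centered_gaussian_field :: "'w measure \<Rightarrow> 'i set \<Rightarrow> ('i \<Rightarrow> 'w \<Rightarrow> real) \<Rightarrow> bool" where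
  "centered_gaussian_field M T Y \<longleftrightarrow>
     (\<forall>J a. finite J \<and> J \<subseteq> T \<longrightarrow> gaussian_rv M (\<lambda>\<omega>. \<Sum>t\<in>J. a t * Y t \<omega>)) \<and>
     (\<forall>t\<in>T. integral\<^sup>L M (Y t) = 0)"

definition same_fdd :: "'w measure \<Rightarrow> 'i set \<Rightarrow> ('i \<Rightarrow> 'w \<Rightarrow> real) \<Rightarrow> ('i \<Rightarrow> 'w \<Rightarrow> real) \<Rightarrow> bool" where
  "same_fdd M T X Y \<longleftrightarrow>
     (\<forall>J. finite J \<and> J \<subseteq> T \<longrightarrow>
        distr M (\<Pi>\<^sub>M t\<in>J. borel) (\<lambda>\<omega>. \<lambda>t\<in>J. X t \<omega>) =
        distr M (\<Pi>\<^sub>M t\<in>J. borel) (\<lambda>\<omega>. \<lambda>t\<in>J. Y t \<omega>))"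

definition independent_fields ::
    "'w measure \<Rightarrow> 'i set \<Rightarrow> ('i \<Rightarrow> 'w \<Rightarrow> real) \<Rightarrow> ('i \<Rightarrow> 'w \<Rightarrow> real) \<Rightarrow> bool" where
  "independent_fields M T X Y \<longleftrightarrow>
     prob_space.indep_var M (\<Pi>\<^sub>M t\<in>T. borel) (\<lambda>\<omega>. \<lambda>t\<in>T. X t \<omega>)
                            (\<Pi>\<^sub>M t\<in>T. borel) (\<lambda>\<omega>. \<lambda>t\<in>T. Y t \<omega>)"

definition fractional_brownian_motion :: "'w measure \<Rightarrow> real \<Rightarrow> (real \<Rightarrow> 'w \<Rightarrow> real) \<Rightarrow> bool" where
  "fractional_brownian_motion M h B \<longleftrightarrow>
     0 < h \<and> h < 1 \<and> centered_gaussian_field M {0..} B \<and>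
     (\<forall>u\<ge>0. \<forall>v\<ge>0. integral\<^sup>L M (\<lambda>\<omega>. B u \<omega> * B v \<omega>) =
        (u powr (2 * h) + v powr (2 * h) - \<bar>u - v\<bar> powr (2 * h)) / 2)"

definition stationary_increments :: "'w measure \<Rightarrow> 'i::real_vector set \<Rightarrow> ('i \<Rightarrow> 'w \<Rightarrow> real) \<Rightarrow> bool" where
  "stationary_increments M T Y \<longleftrightarrow>
     (\<forall>h\<in>T. same_fdd M T (\<lambda>u \<omega>. Y (u + h) \<omega> - Y h \<omega>) (\<lambda>u \<omega>. Y u \<omega> - Y 0 \<omega>))"


section \<open>Operator scaling\<close>

text \<open>The operator \<open>c\<^sup>E\<close>, evaluated at a vector; \<open>E ^^ n\<close> is the \<open>n\<close>-fold composition (the ring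
  power on the vector type would be taken componentwise).\<close>

definition op_powr :: "real \<Rightarrow> (real^'n \<Rightarrow> real^'n) \<Rightarrow> real^'n \<Rightarrow> real^'n" where
  "op_powr c E x = (\<Sum>n. (ln c ^ n / fact n) *\<^sub>R (E ^^ n) x)"

definition complex_eigenvalue :: "(real^'n \<Rightarrow> real^'n) \<Rightarrow> complex \<Rightarrow> bool" where
  "complex_eigenvalue E l \<longleftrightarrow>
     (\<exists>v::complex^'n. v \<noteq> 0 \<and> (\<chi> i j. complex_of_real (matrix E $ i $ j)) *v v = l *s v)"

text \<open>The factor on the state space is \<open>c\<close> itself: the exponent \<open>E\<close> is normalised so that no
  further index occurs. Substituting \<open>c powr (1/b)\<close> for \<open>c\<close> shows that a field whose versions
  \<open>Y (c\<^sup>H t)\<close> and \<open>c powr b * Y t\<close> agree in law, for some \<open>b > 0\<close>, has the exponent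
  \<open>(1/b) H\<close> in this sense.\<close>

definition operator_scaling ::
    "'w measure \<Rightarrow> (real^'n) set \<Rightarrow> (real^'n \<Rightarrow> real^'n) \<Rightarrow> (real^'n \<Rightarrow> 'w \<Rightarrow> real) \<Rightarrow> bool" where
  "operator_scaling M T E Y \<longleftrightarrow>
     linear E \<and> (\<forall>l. complex_eigenvalue E l \<longrightarrow> 0 < Re l) \<and>
     (\<forall>c>0. op_powr c E ` T \<subseteq> T) \<and>
     (\<forall>c>0. same_fdd M T (\<lambda>t. Y (op_powr c E t)) (\<lambda>t \<omega>. c * Y t \<omega>))"

definition diag_matrix :: "('n \<Rightarrow> real) \<Rightarrow> real^'n^'n" where
  "diag_matrix a = (\<chi> i j. if i = j then a i else 0)"


definition alpha_bar :: "('n::finite \<Rightarrow> real) \<Rightarrow> real" where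
  "alpha_bar \<alpha> = (\<Sum>k\<in>UNIV. 1 / \<alpha> k)"


section \<open>The limit covariances\<close>

definition orthant :: "(real^'n) set" where
  "orthant = {u. \<forall>k. 0 \<le> u $ k}"

definition D :: "real^'n \<Rightarrow> (real^'n) set" where
  "D u = {x. \<forall>k. 0 \<le> x $ k \<and> x $ k \<le> u $ k}"

definition fourier :: "(real^'n \<Rightarrow> real) \<Rightarrow> real^'n \<Rightarrow> complex" where
  "fourier \<phi> z = (\<integral>x. exp (\<i> * complex_of_real (x \<bullet> z)) * complex_of_real (\<phi> x) \<partial>lborel)"

definition stable_symbol :: "('n::finite \<Rightarrow> real) \<Rightarrow> real^'n \<Rightarrow> real" where
  "stable_symbol \<alpha> z = (\<Sum>k\<in>UNIV. \<bar>z $ k\<bar> powr \<alpha> k)"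

text \<open>The covariance of the values at \<open>(r, \<phi>\<^sub>1)\<close> and \<open>(t, \<phi>\<^sub>2)\<close> of the distribution-valued process with
  spectral density \<open>\<kappa>\<close>.\<close>

definition spectral_cov ::
    "(real^'n \<Rightarrow> real) \<Rightarrow> real \<Rightarrow> real \<Rightarrow> real \<Rightarrow> (real^'n \<Rightarrow> real) \<Rightarrow> (real^'n \<Rightarrow> real) \<Rightarrow> complex" where
  "spectral_cov \<kappa> \<theta> r t \<phi>\<^sub>1 \<phi>\<^sub>2 =
     1 / (2 * complex_of_real pi) ^ CARD('n) *
     (\<integral>z. complex_of_real (\<kappa> z) * fourier \<phi>\<^sub>1 z * cnj (fourier \<phi>\<^sub>2 z) \<partial>lborel) *
     complex_of_real (LBINT s:{0..min r t}. exp (- \<theta> * s))"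

text \<open>The field \<open>Y(u)\<close> is the value of that process at time \<open>1\<close> on the indicator of \<open>D u\<close>; as a
  Gaussian field its law is determined by its covariance.\<close>

definition occupation_field ::
    "'w measure \<Rightarrow> (real^'n \<Rightarrow> real) \<Rightarrow> real \<Rightarrow> (real^'n \<Rightarrow> 'w \<Rightarrow> real) \<Rightarrow> bool" where
  "occupation_field M \<kappa> \<theta> Y \<longleftrightarrow>
     centered_gaussian_field M orthant Y \<and>
     (\<forall>u\<in>orthant. \<forall>v\<in>orthant.
        complex_of_real (integral\<^sup>L M (\<lambda>\<omega>. Y u \<omega> * Y v \<omega>)) =
        spectral_cov \<kappa> \<theta> 1 1 (indicator (D u)) (indicator (D v)))"

end

theory Submission
  imports Defs
begin

text \<open>
  Both covariances are integrals of \<open>C / S(z)^m\<close>, where \<open>S(z) = \<Sum>k. \<bar>z k\<bar> powr \<alpha> k\<close>, against a product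
  of Fourier transforms of boxes, with \<open>m = 1\<close> and \<open>m = 2\<close>. Everything follows from four facts about
  such integrals, so both fields are treated together for any \<open>m\<close> between \<open>0\<close> and
  \<open>\<Sum>k. 1 / \<alpha> k\<close> (both exclusive).

  Finiteness. Each \<open>\<bar>z k\<bar>\<close> is at most \<open>S(z) powr (1 / \<alpha> k)\<close>; multiplying over \<open>k\<close> bounds \<open>1 / S^m\<close>
  by a product of powers \<open>\<bar>z k\<bar> powr (-s)\<close> with \<open>s < 1\<close>. The transform of a box is a product of
  transforms of segments, which are bounded and decay like \<open>1 / \<bar>z k\<bar>\<close>. The \<open>d\<close>-dimensional
  integral is therefore dominated by a product of convergent one-dimensional ones.

  Scaling. The substitution \<open>z k \<mapsto> c powr (\<sigma> / \<alpha> k) * z k\<close> multiplies \<open>S\<close> by \<open>c powr \<sigma>\<close>, and it dilates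
  the transforms as it dilates the boxes. It multiplies the covariance by
  \<open>c powr (\<sigma> * (m + \<Sum>k. 1 / \<alpha> k))\<close>, which is \<open>c\<^sup>2\<close> for the exponent \<open>\<sigma>\<close> of the theorem. Equality of
  covariances gives equality of finite-dimensional laws, because linear combinations of a centered
  Gaussian field have laws determined by their variances, and the laws of all linear combinations
  determine the joint law (Cramer and Wold).

  Degeneracy. A box with an edge of length \<open>0\<close> is a null set, so the field vanishes on the faces of
  the orthant, whereas its value at \<open>(1, \<dots>, 1)\<close> has positive variance. If \<open>d \<ge> 2\<close>, the point
  \<open>(1, \<dots>, 1)\<close> is the sum \<open>u + h\<close> of two points on faces: the increment from \<open>h\<close> to \<open>u + h\<close> is
  nondegenerate and the one from \<open>0\<close> to \<open>u\<close> is zero, which excludes stationary increments.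

  Dimension one. The real part of the integrand is
  \<open>(1 - cos u x) + (1 - cos v x) - (1 - cos (u - v) x)\<close> times \<open>C * \<bar>x\<bar> powr (- m \<alpha> - 2)\<close>, and
  \<open>\<integral> (1 - cos a x) * \<bar>x\<bar> powr (- m \<alpha> - 2) dx\<close> is a constant times \<open>\<bar>a\<bar> powr (1 + m \<alpha>)\<close>, again by
  substitution. This is the covariance of a fractional Brownian motion.
\<close>

section \<open>Integrals of products of functions of one coordinate\<close>

lemma cis_measurable [measurable]: "cis \<in> borel_measurable borel"
  by (intro borel_measurable_continuous_onI continuous_intros)

lemma cnj_measurable [measurable]: "cnj \<in> borel_measurable borel"
  by (intro borel_measurable_continuous_onI continuous_intros)

lemma vec_lambda_measurable_PiM [measurable]:
  "(\<lambda>f. \<chi> k. f k :: real^'n) \<in> (\<Pi>\<^sub>M k\<in>UNIV. lborel) \<rightarrow>\<^sub>M borel"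
  by (subst borel_measurable_euclidean_space) (auto simp: Basis_vec_def inner_axis)

text \<open>On \<open>real^'n\<close> the general construction of Lebesgue measure runs over the set \<open>Basis\<close>; this
  version runs over the index type, so that it combines with products over \<open>k\<in>UNIV\<close>.\<close>

lemma lborel_vec_eq_distr_PiM:
  "(lborel :: (real^'n) measure) = distr (\<Pi>\<^sub>M k\<in>UNIV. lborel) borel (\<lambda>f. \<chi> k. f k)"
proof (rule lborel_eqI)
  interpret product_sigma_finite "\<lambda>_::'n. lborel :: real measure" ..
  fix l u :: "real^'n"
  assume lu: "\<And>b. b \<in> Basis \<Longrightarrow> l \<bullet> b \<le> u \<bullet> b"
  have le: "l $ k \<le> u $ k" for k
    using lu[of "axis k 1"] by (simp add: inner_axis axis_in_Basis_iff)
  have "(\<lambda>f. \<chi> k. f k :: real^'n) -` box l u \<inter> space (\<Pi>\<^sub>M k\<in>UNIV. lborel) =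
      (\<Pi>\<^sub>E k\<in>UNIV. {l $ k <..< u $ k})"
    by (auto simp: mem_box_cart space_PiM PiE_iff)
  then have "emeasure (distr (\<Pi>\<^sub>M k\<in>UNIV. lborel) borel (\<lambda>f. \<chi> k. f k)) (box l u) =
      (\<Prod>k\<in>UNIV. emeasure lborel {l $ k <..< u $ k})"
    by (simp add: emeasure_distr emeasure_PiM)
  also have "\<dots> = (\<Prod>k\<in>UNIV. ennreal (u $ k - l $ k))"
    using le by simp
  also have "\<dots> = ennreal (\<Prod>k\<in>UNIV. u $ k - l $ k)"
    using le by (simp add: prod_ennreal)
  also have "(\<Prod>k\<in>UNIV. u $ k - l $ k) = (\<Prod>b\<in>Basis. (u - l) \<bullet> b)"
  proof -
    have "bij_betw (\<lambda>k. axis k 1 :: real^'n) UNIV Basis"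
      by (auto simp: bij_betw_def inj_on_def axis_eq_axis Basis_vec_def)
    from prod.reindex_bij_betw[OF this, of "\<lambda>b. (u - l) \<bullet> b"] show ?thesis
      by (simp add: inner_axis)
  qed
  finally show "emeasure (distr (\<Pi>\<^sub>M k\<in>UNIV. lborel) borel (\<lambda>f. \<chi> k. f k)) (box l u) =
      ennreal (\<Prod>b\<in>Basis. (u - l) \<bullet> b)" .
qed simp

lemma
  fixes f :: "'n::finite \<Rightarrow> real \<Rightarrow> 'b::{real_normed_field, banach, second_countable_topology}"
  assumes f: "\<And>k. integrable lborel (f k)"
  shows integrable_prod_coordinates: "integrable lborel (\<lambda>z::real^'n. \<Prod>k\<in>UNIV. f k (z $ k))" (is ?I)
    and integral_prod_coordinates:
      "(\<integral>z. (\<Prod>k\<in>UNIV. f k (z $ k)) \<partial>(lborel :: (real^'n) measure)) = (\<Prod>k\<in>UNIV. integral\<^sup>L lborel (f k))" (is ?E)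
proof -
  interpret product_sigma_finite "\<lambda>_::'n. lborel :: real measure" ..
  have [measurable]: "f k \<in> borel_measurable borel" for k
    using borel_measurable_integrable[OF f[of k]] by simp
  show ?I
    unfolding lborel_vec_eq_distr_PiM
    by (subst integrable_distr_eq) (auto intro!: product_integrable_prod f)
  show ?E
    unfolding lborel_vec_eq_distr_PiM
    by (subst integral_distr) (auto intro!: product_integral_prod f)
qed

lemma AE_lborel_coordinates_nonzero: "AE z in lborel. \<forall>k. (z::real^'n) $ k \<noteq> 0"
proof -
  have "AE z in lborel. (z::real^'n) $ k \<noteq> 0" for k
  proof -
    have "negligible {z::real^'n. z $ k = 0}"
      by (rule negligible_standard_hyperplane_cart)
    then have "{z::real^'n. z $ k = 0} \<in> null_sets lebesgue"
      by (simp add: negligible_iff_null_sets)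
    moreover have "{z::real^'n. z $ k = 0} \<in> sets lborel"
      by measurable
    ultimately have "{z::real^'n. z $ k = 0} \<in> null_sets lborel"
      by (auto simp: null_sets_def)
    then show ?thesis
      by (rule AE_I') auto
  qed
  then show ?thesis
    by (simp add: AE_all_countable)
qed

section \<open>Fourier transforms of boxes\<close>

text \<open>The transform of the indicator of \<open>{0..a}\<close>. The value \<open>a\<close> at \<open>x = 0\<close> makes it continuous, and it
  makes the scaling relation below hold at every point instead of almost everywhere.\<close>

definition segment_fourier :: "real \<Rightarrow> real \<Rightarrow> complex" where
  "segment_fourier a x = (if x = 0 then of_real a else (cis (a * x) - 1) / (\<i> * of_real x))"

lemma segment_fourier_measurable [measurable]: "segment_fourier a \<in> borel_measurable borel"
  unfolding segment_fourier_def by measurable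

lemma has_bochner_integral_segment_fourier:
  assumes "0 \<le> a"
  shows "has_bochner_integral lborel (\<lambda>t. indicator {0..a} t *\<^sub>R cis (t * x)) (segment_fourier a x)"
proof (cases "x = 0")
  case True
  have "has_bochner_integral lborel (\<lambda>t. indicator {0..a} t *\<^sub>R (1::complex)) (of_real a - of_real 0)"
    by (rule has_bochner_integral_FTC_Icc[OF assms]) (auto intro!: derivative_eq_intros has_vector_derivative_of_real)
  then show ?thesis using True by (simp add: segment_fourier_def)
next
  case False
  let ?G = "\<lambda>t. cis (t * x) / (\<i> * of_real x)"
  have "(?G has_vector_derivative cis (t * x)) (at t within {0..a})" for t
    using False by (auto intro!: derivative_eq_intros simp: has_vector_derivative_def field_simps scaleR_conv_of_real)
  then have "has_bochner_integral lborel (\<lambda>t. indicator {0..a} t *\<^sub>R cis (t * x)) (?G a - ?G 0)"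
    by (intro has_bochner_integral_FTC_Icc[OF assms] continuous_intros) auto
  then show ?thesis using False by (simp add: segment_fourier_def diff_divide_distrib)
qed

lemma norm_segment_fourier_le_length:
  assumes "0 \<le> a" shows "norm (segment_fourier a x) \<le> a"
proof -
  have "norm (segment_fourier a x) \<le> (\<integral>t. norm (indicator {0..a} t *\<^sub>R cis (t * x)) \<partial>lborel)"
    using has_bochner_integral_segment_fourier[OF assms, of x]
    by (metis has_bochner_integral_iff integral_norm_bound)
  also have "\<dots> = (\<integral>t. indicator {0..a} t \<partial>lborel)"
    by (simp add: norm_mult)
  finally show ?thesis using assms by simp
qed

lemma norm_segment_fourier_le_inverse: "norm (segment_fourier a x) \<le> (if x = 0 then \<bar>a\<bar> else 2 / \<bar>x\<bar>)"
proof -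
  have "norm (cis (a * x) - 1) \<le> 2"
    using norm_triangle_ineq4[of "cis (a * x)" 1] by simp
  then show ?thesis
    by (auto simp: segment_fourier_def norm_divide norm_mult divide_right_mono)
qed

lemma segment_fourier_scale:
  assumes "c \<noteq> 0" shows "segment_fourier (c * a) x = of_real c * segment_fourier a (c * x)"
  using assms by (simp add: segment_fourier_def field_simps)

lemma fourier_indicator_D:
  assumes "u \<in> orthant"
  shows "fourier (indicator (D u)) z = (\<Prod>k\<in>UNIV. segment_fourier (u $ k) (z $ k))"
proof -
  have u: "0 \<le> u $ k" for k using assms by (simp add: orthant_def)
  have "exp (\<i> * complex_of_real (x \<bullet> z)) * complex_of_real (indicator (D u) x) =
      (\<Prod>k\<in>UNIV. indicator {0..u $ k} (x $ k) *\<^sub>R cis (x $ k * z $ k))" for x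
  proof -
    have "(\<Prod>k\<in>UNIV. indicator {0..u $ k} (x $ k) :: real) = indicator (D u) x"
    proof (cases "x \<in> D u")
      case False
      then obtain k where "x $ k \<notin> {0..u $ k}" by (auto simp: D_def)
      then have "(\<Prod>k\<in>UNIV. indicator {0..u $ k} (x $ k) :: real) = 0"
        by (intro prod_zero) (auto simp: indicator_def)
      with False show ?thesis by simp
    qed (simp add: D_def)
    then have "(\<Prod>k\<in>UNIV. complex_of_real (indicator {0..u $ k} (x $ k))) = of_real (indicator (D u) x)"
      by (metis of_real_prod)
    then show ?thesis
      by (simp add: scaleR_conv_of_real prod.distrib inner_vec_def cis_conv_exp exp_sum sum_distrib_left)
  qed
  then have "fourier (indicator (D u)) z =
      (\<integral>x. (\<Prod>k\<in>UNIV. indicator {0..u $ k} (x $ k) *\<^sub>R cis (x $ k * z $ k)) \<partial>lborel)"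
    by (simp add: fourier_def)
  also have "\<dots> = (\<Prod>k\<in>UNIV. \<integral>t. indicator {0..u $ k} t *\<^sub>R cis (t * z $ k) \<partial>lborel)"
    using has_bochner_integral_segment_fourier[OF u]
    by (intro integral_prod_coordinates) (simp add: has_bochner_integral_iff)
  also have "\<dots> = (\<Prod>k\<in>UNIV. segment_fourier (u $ k) (z $ k))"
    using has_bochner_integral_segment_fourier[OF u] by (simp add: has_bochner_integral_iff)
  finally show ?thesis .
qed

text \<open>The powers below have an integrable singularity at \<open>0\<close>, for which the gauge integral has the needed
  evaluations; nonnegativity turns these into Lebesgue integrability.\<close>

lemma integrable_lborel_of_integrable_on_nonneg:
  fixes f :: "real \<Rightarrow> real"
  assumes [measurable]: "f \<in> borel_measurable borel" "A \<in> sets borel"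
    and "f integrable_on A" "\<And>x. x \<in> A \<Longrightarrow> 0 \<le> f x"
  shows "integrable lborel (\<lambda>x. indicator A x * f x)"
proof -
  have "f absolutely_integrable_on A"
    by (rule nonnegative_absolutely_integrable_1) fact+
  then have "integrable lebesgue (\<lambda>x. indicator A x * f x)"
    by (simp add: set_integrable_def)
  then show ?thesis
    by (subst (asm) integrable_completion) auto
qed

text \<open>Near \<open>0\<close> the two transforms are bounded by \<open>a\<close> and \<open>b\<close>, and \<open>\<bar>x\<bar> powr (-s)\<close> is integrable as \<open>s < 1\<close>;
  near infinity the transforms decay like \<open>2 / \<bar>x\<bar>\<close> each, which leaves \<open>\<bar>x\<bar> powr (-s-2)\<close>.\<close>

lemma integrable_powr_segment_fourier:
  assumes s: "s < 1" "0 \<le> s" and a: "0 \<le> a" and b: "0 \<le> b"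
  shows "integrable lborel (\<lambda>x. \<bar>x\<bar> powr (- s) * (norm (segment_fourier a x) * norm (segment_fourier b x)))"
proof -
  \<comment> \<open>The even function \<open>w x + w (- x)\<close> is the majorant, up to a constant that serves both ranges.\<close>
  define w where "w x = indicator {0..1} x * x powr (- s) + indicator {1..} x * x powr (- s - 2)" for x :: real
  have "integrable lborel w"
    unfolding w_def using s
    by (intro Bochner_Integration.integrable_add integrable_lborel_of_integrable_on_nonneg
        integrable_on_powr_from_0 has_integral_integrable[OF has_integral_powr_to_inf]) auto
  moreover from this have "integrable lborel (\<lambda>x. w (- x))"
    using lborel_integrable_real_affine[of w "-1" 0] by simp
  ultimately have "integrable lborel (\<lambda>x. (a * b + 4) * (w x + w (- x)))"
    by simp
  then show ?thesis
  proof (rule Bochner_Integration.integrable_bound)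
    have "\<bar>x\<bar> powr (- s) * (norm (segment_fourier a x) * norm (segment_fourier b x)) \<le> (a * b + 4) * (w x + w (- x))" for x
    proof (cases "x = 0")
      case False
      have w0: "0 \<le> w y" for y by (simp add: w_def)
      let ?P = "norm (segment_fourier a x) * norm (segment_fourier b x)"
      have ab: "0 \<le> a * b" using a b by simp
      have P1: "?P \<le> a * b"
        using norm_segment_fourier_le_length[OF a] norm_segment_fourier_le_length[OF b] a by (intro mult_mono) auto
      have "?P \<le> (2 / \<bar>x\<bar>) * (2 / \<bar>x\<bar>)"
        using norm_segment_fourier_le_inverse[of a x] norm_segment_fourier_le_inverse[of b x] False by (intro mult_mono) auto
      also have "\<dots> = 4 * \<bar>x\<bar> powr (- 2)"
        using False by (simp add: powr_minus_divide powr_numeral power2_eq_square)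
      finally have P2: "?P \<le> 4 * \<bar>x\<bar> powr (- 2)" .
      have "\<bar>x\<bar> powr (- s) * ?P \<le> (a * b + 4) * w \<bar>x\<bar>"
      proof (cases "\<bar>x\<bar> \<le> 1")
        case True
        then have "\<bar>x\<bar> powr (- s) \<le> w \<bar>x\<bar>" by (simp add: w_def)
        then have "\<bar>x\<bar> powr (- s) * ?P \<le> w \<bar>x\<bar> * (a * b + 4)"
          using P1 w0 by (intro mult_mono) auto
        then show ?thesis by (simp add: mult.commute)
      next
        case False
        have "\<bar>x\<bar> powr (- s) * ?P \<le> \<bar>x\<bar> powr (- s) * (4 * \<bar>x\<bar> powr (- 2))"
          using P2 by (intro mult_left_mono) auto
        also have "\<dots> = 4 * \<bar>x\<bar> powr (- s - 2)"
          using powr_add[of "\<bar>x\<bar>" "- s" "- 2"] by simp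
        also have "\<dots> = 4 * w \<bar>x\<bar>"
          using False by (simp add: w_def)
        also have "\<dots> \<le> (a * b + 4) * w \<bar>x\<bar>"
          using ab w0 by (intro mult_right_mono) auto
        finally show ?thesis .
      qed
      also have "\<dots> \<le> (a * b + 4) * (w x + w (- x))"
        using ab w0[of x] w0[of "- x"] by (intro mult_left_mono) (auto simp: abs_if)
      finally show ?thesis .
    next
      case True
      then show ?thesis using a b by (simp add: w_def)
    qed
    then show "AE x in lborel. norm (\<bar>x\<bar> powr (- s) * (norm (segment_fourier a x) * norm (segment_fourier b x)))
        \<le> norm ((a * b + 4) * (w x + w (- x)))"
      by (intro AE_I2) (metis abs_ge_self order_trans abs_of_nonneg mult_nonneg_nonneg norm_ge_zero powr_ge_zero real_norm_def)
  qed measurable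
qed

section \<open>Integrability of the spectral integrands\<close>

lemma alpha_bar_pos: "(\<And>k. 0 < \<alpha> k) \<Longrightarrow> 0 < alpha_bar \<alpha>"
  unfolding alpha_bar_def by (intro sum_pos) auto

lemma stable_symbol_nonneg: "0 \<le> stable_symbol \<alpha> z"
  unfolding stable_symbol_def by (intro sum_nonneg) auto

lemma stable_symbol_pos: "z $ k \<noteq> 0 \<Longrightarrow> 0 < stable_symbol \<alpha> z"
  unfolding stable_symbol_def by (intro sum_pos2[of _ k]) auto

lemma stable_symbol_measurable [measurable]: "stable_symbol \<alpha> \<in> borel_measurable borel"
  unfolding stable_symbol_def by measurable

text \<open>Every coordinate satisfies \<open>\<bar>z k\<bar> \<le> S powr (1 / \<alpha> k)\<close>, since \<open>\<bar>z k\<bar> powr \<alpha> k\<close> is one of the nonnegative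
  summands of \<open>S\<close>. The product over \<open>k\<close> of these bounds is \<open>S powr (alpha_bar \<alpha>)\<close>. Unlike \<open>1 / S^m\<close>,
  the bound factors over the coordinates.\<close>

lemma inverse_stable_symbol_power_le_prod:
  assumes \<alpha>: "\<And>k. 0 < \<alpha> k" and z: "\<And>k. z $ k \<noteq> 0"
  shows "1 / stable_symbol \<alpha> z ^ m \<le> (\<Prod>k\<in>UNIV. \<bar>z $ k\<bar> powr (- (m / alpha_bar \<alpha>)))"
proof -
  let ?S = "stable_symbol \<alpha> z" and ?b = "alpha_bar \<alpha>"
  have S: "0 < ?S" using stable_symbol_pos[OF z] .
  have b: "0 < ?b" using alpha_bar_pos \<alpha> by blast
  have coordinate: "\<bar>z $ k\<bar> \<le> ?S powr (1 / \<alpha> k)" for k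
  proof -
    have "\<bar>z $ k\<bar> powr \<alpha> k \<le> ?S"
      unfolding stable_symbol_def by (rule member_le_sum) auto
    then have "(\<bar>z $ k\<bar> powr \<alpha> k) powr (1 / \<alpha> k) \<le> ?S powr (1 / \<alpha> k)"
      using \<alpha>[of k] by (intro powr_mono2) auto
    then show ?thesis using \<alpha>[of k] z[of k] by (simp add: powr_powr)
  qed
  have "(\<Prod>k\<in>UNIV. \<bar>z $ k\<bar>) \<le> (\<Prod>k\<in>UNIV. ?S powr (1 / \<alpha> k))"
    using coordinate by (intro prod_mono) auto
  also have "\<dots> = ?S powr ?b"
    using S by (simp add: alpha_bar_def powr_sum)
  finally have "(\<Prod>k\<in>UNIV. \<bar>z $ k\<bar>) powr (m / ?b) \<le> (?S powr ?b) powr (m / ?b)"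
    using b by (intro powr_mono2) (auto intro: prod_nonneg)
  also have "\<dots> = ?S ^ m"
    using S b by (simp add: powr_powr powr_realpow)
  finally have "1 / ?S ^ m \<le> 1 / (\<Prod>k\<in>UNIV. \<bar>z $ k\<bar>) powr (m / ?b)"
    using z by (intro divide_left_mono mult_pos_pos) (auto simp: S intro!: prod_pos)
  also have "\<dots> = (\<Prod>k\<in>UNIV. \<bar>z $ k\<bar> powr (- (m / ?b)))"
    by (simp add: powr_minus inverse_eq_divide prod_powr_distrib prod_dividef)
  finally show ?thesis .
qed

lemma fourier_indicator_D_measurable:
  assumes "u \<in> orthant"
  shows "fourier (indicator (D u)) \<in> borel_measurable borel"
  unfolding fourier_indicator_D[OF assms, abs_def] by measurable

text \<open>The exponent \<open>m / alpha_bar \<alpha>\<close> of the factorised bound is below \<open>1\<close> exactly when \<open>m < alpha_bar \<alpha>\<close>,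
  which makes every factor integrable near \<open>0\<close>.\<close>

lemma integrable_spectral_integrand:
  fixes u v :: "real^'n"
  assumes \<alpha>: "\<And>k. 0 < \<alpha> k" and m: "m < alpha_bar \<alpha>" and u: "u \<in> orthant" and v: "v \<in> orthant"
  shows "integrable lborel (\<lambda>z. complex_of_real (C / stable_symbol \<alpha> z ^ m) *
      fourier (indicator (D u)) z * cnj (fourier (indicator (D v)) z))"
proof -
  let ?s = "m / alpha_bar \<alpha>"
  have b: "0 < alpha_bar \<alpha>" using alpha_bar_pos \<alpha> by blast
  note [measurable] = fourier_indicator_D_measurable[OF u] fourier_indicator_D_measurable[OF v]
  let ?g = "\<lambda>k x. \<bar>x\<bar> powr (- ?s) * (norm (segment_fourier (u $ k) x) * norm (segment_fourier (v $ k) x))"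
  have "integrable lborel (?g k)" for k
    using u v m b by (intro integrable_powr_segment_fourier) (auto simp: orthant_def)
  then have "integrable lborel (\<lambda>z::real^'n. \<bar>C\<bar> * (\<Prod>k\<in>UNIV. ?g k (z $ k)))"
    by (intro integrable_mult_right integrable_prod_coordinates)
  then show ?thesis
  proof (rule Bochner_Integration.integrable_bound)
    show "AE z in lborel. norm (complex_of_real (C / stable_symbol \<alpha> z ^ m) *
          fourier (indicator (D u)) z * cnj (fourier (indicator (D v)) z))
        \<le> norm (\<bar>C\<bar> * (\<Prod>k\<in>UNIV. ?g k (z $ k)))"
      using AE_lborel_coordinates_nonzero
    proof eventually_elim
      case (elim z)
      let ?P = "\<Prod>k\<in>UNIV. norm (segment_fourier (u $ k) (z $ k)) * norm (segment_fourier (v $ k) (z $ k))"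
      have "norm (complex_of_real (C / stable_symbol \<alpha> z ^ m) *
          fourier (indicator (D u)) z * cnj (fourier (indicator (D v)) z)) =
          \<bar>C\<bar> * (1 / stable_symbol \<alpha> z ^ m * ?P)"
        by (simp add: fourier_indicator_D u v norm_mult norm_divide norm_power prod.distrib prod_norm[symmetric]
            stable_symbol_nonneg)
      also have "\<dots> \<le> \<bar>C\<bar> * ((\<Prod>k\<in>UNIV. \<bar>z $ k\<bar> powr (- ?s)) * ?P)"
        using elim \<alpha> by (intro mult_left_mono mult_right_mono inverse_stable_symbol_power_le_prod) (auto intro!: prod_nonneg)
      also have "\<dots> = \<bar>C\<bar> * (\<Prod>k\<in>UNIV. ?g k (z $ k))"
        by (simp add: prod.distrib)
      also have "\<dots> \<le> norm \<dots>" by simp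
      finally show ?case .
    qed
  qed measurable
qed

section \<open>Scaling and degeneracy of the covariances\<close>

text \<open>The general affine substitution has its factors indexed by basis vectors; the function \<open>d\<close> below
  recovers \<open>c k\<close> from the basis vector \<open>axis k 1\<close>.\<close>

lemma integral_diagonal_substitution:
  fixes g :: "real^'n \<Rightarrow> 'b::{banach, second_countable_topology}"
  assumes c: "\<And>k. 0 < c k" and [measurable]: "g \<in> borel_measurable borel"
  shows "integral\<^sup>L lborel g = (\<Prod>k\<in>UNIV. c k) *\<^sub>R (\<integral>z. g (\<chi> k. c k * z $ k) \<partial>lborel)"
proof -
  define d where "d b = (\<Sum>k\<in>UNIV. c k * b $ k)" for b :: "real^'n"
  have d: "d (axis k 1) = c k" for k
    by (simp add: d_def axis_def if_distrib[of "\<lambda>x. _ * x"] cong: if_cong)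
  have bij: "bij_betw (\<lambda>k. axis k 1 :: real^'n) UNIV Basis"
    by (auto simp: bij_betw_def inj_on_def axis_eq_axis Basis_vec_def)
  have T: "(0 + (\<Sum>j\<in>Basis. (d j * (z \<bullet> j)) *\<^sub>R j)) = (\<chi> k. c k * z $ k)" for z
  proof -
    have "(\<Sum>j\<in>Basis. (d j * (z \<bullet> j)) *\<^sub>R j) = (\<Sum>k\<in>UNIV. (c k * z $ k) *\<^sub>R axis k (1::real))"
      using sum.reindex_bij_betw[OF bij, of "\<lambda>j. (d j * (z \<bullet> j)) *\<^sub>R j"] by (simp add: d inner_axis)
    then show ?thesis
      by (simp add: vec_eq_iff axis_def if_distrib[of "\<lambda>x. _ * x"] cong: if_cong)
  qed
  have P: "(\<Prod>j\<in>Basis. \<bar>d j\<bar>) = (\<Prod>k\<in>UNIV. c k)"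
    using prod.reindex_bij_betw[OF bij, of "\<lambda>j. \<bar>d j\<bar>"] c by (simp add: d less_imp_le)
  have "d j \<noteq> 0" if "j \<in> Basis" for j
    using that c by (auto simp: Basis_vec_def d less_imp_neq[symmetric])
  from lborel_affine_euclidean[where c=d and t=0, OF this]
  have L: "(lborel :: (real^'n) measure) =
      density (distr lborel borel (\<lambda>z. \<chi> k. c k * z $ k)) (\<lambda>_. \<Prod>k\<in>UNIV. c k)"
    unfolding T P .
  have [measurable]: "(\<lambda>z. \<chi> k. c k * z $ k :: real^'n) \<in> borel \<rightarrow>\<^sub>M borel"
    by (subst borel_measurable_euclidean_space) (auto simp: Basis_vec_def inner_axis)
  have "0 \<le> (\<Prod>k\<in>UNIV. c k)" using c by (intro prod_nonneg) (auto intro: less_imp_le)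
  then show ?thesis
    by (subst L) (simp add: integral_density integral_distr)
qed

text \<open>With \<open>T z = (\<chi> k. c k * z $ k)\<close> and \<open>p\<close> its determinant, dilating the boxes replaces each
  transform \<open>f\<close> by \<open>p * f (T z)\<close>. Writing \<open>\<kappa> z = q * \<kappa> (T z)\<close> makes the whole integrand \<open>q * p\<^sup>2\<close>
  times a function of \<open>T z\<close>, and the substitution gives one factor \<open>p\<close> back.\<close>

lemma spectral_cov_diagonal_scaling:
  fixes u v :: "real^'n"
  assumes c: "\<And>k. 0 < c k" and [measurable]: "\<kappa> \<in> borel_measurable borel"
    and \<kappa>: "\<And>z. \<kappa> z = q * \<kappa> (\<chi> k. c k * z $ k)" and u: "u \<in> orthant" and v: "v \<in> orthant"
  shows "spectral_cov \<kappa> \<theta> r t (indicator (D (\<chi> k. c k * u $ k))) (indicator (D (\<chi> k. c k * v $ k))) =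
    of_real (q * (\<Prod>k\<in>UNIV. c k)) * spectral_cov \<kappa> \<theta> r t (indicator (D u)) (indicator (D v))"
proof -
  let ?T = "\<lambda>z::real^'n. \<chi> k. c k * z $ k" and ?p = "\<Prod>k\<in>UNIV. c k"
  have Tu: "?T w \<in> orthant" if "w \<in> orthant" for w
    using that c by (simp add: orthant_def less_imp_le)
  have c0: "c k \<noteq> 0" for k using c[of k] by simp
  have fT: "fourier (indicator (D (?T w))) z = of_real ?p * fourier (indicator (D w)) (?T z)" if "w \<in> orthant" for w z
    using that by (simp add: fourier_indicator_D Tu segment_fourier_scale[OF c0] prod.distrib)
  note [measurable] = fourier_indicator_D_measurable[OF u] fourier_indicator_D_measurable[OF v]
  let ?G = "\<lambda>z. complex_of_real (\<kappa> z) * fourier (indicator (D u)) z * cnj (fourier (indicator (D v)) z)"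
  have "(\<integral>z. complex_of_real (\<kappa> z) * fourier (indicator (D (?T u))) z * cnj (fourier (indicator (D (?T v))) z) \<partial>lborel) =
      (\<integral>z. of_real (q * ?p * ?p) * ?G (?T z) \<partial>lborel)"
    by (subst \<kappa>) (simp add: fT u v mult_ac del: of_real_prod)
  also have "\<dots> = of_real (q * ?p) * (?p *\<^sub>R (\<integral>z. ?G (?T z) \<partial>lborel))"
    by (simp add: scaleR_conv_of_real del: of_real_prod)
  also have "?p *\<^sub>R (\<integral>z. ?G (?T z) \<partial>lborel) = integral\<^sup>L lborel ?G"
    using c by (intro integral_diagonal_substitution[symmetric]) auto
  finally show ?thesis
    by (simp add: spectral_cov_def mult_ac del: of_real_prod)
qed

lemma spectral_cov_null_box:
  assumes "u \<in> orthant" "u $ k = 0"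
  shows "spectral_cov \<kappa> \<theta> r t (indicator (D u)) \<phi> = 0"
proof -
  have "segment_fourier (u $ k) x = 0" for x
    by (simp add: segment_fourier_def assms(2))
  then have "fourier (indicator (D u)) z = 0" for z
    using assms by (auto simp: fourier_indicator_D intro!: exI[of _ k])
  then show ?thesis by (simp add: spectral_cov_def)
qed

lemma exponential_time_integral_pos: "0 < (LBINT s:{0..min 1 1}. exp (- \<theta> * s :: real))"
proof -
  have int: "set_integrable lborel {0..1} (\<lambda>s. exp (- \<theta> * s))"
    by (intro borel_integrable_atLeastAtMost' continuous_intros)
  have "exp (- \<bar>\<theta>\<bar>) = (LBINT s:{0..1::real}. exp (- \<bar>\<theta>\<bar>))"
    by (simp add: set_lebesgue_integral_def)
  also have "\<dots> \<le> (LBINT s:{0..1}. exp (- \<theta> * s))"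
  proof (rule set_integral_mono[OF _ int])
    show "set_integrable lborel {0..1} (\<lambda>s::real. exp (- \<bar>\<theta>\<bar>))"
      by (intro borel_integrable_atLeastAtMost' continuous_intros)
    fix s :: real assume "s \<in> {0..1}"
    then have "\<theta> * s \<le> \<bar>\<theta>\<bar> * 1"
      by (metis abs_ge_self abs_ge_zero atLeastAtMost_iff mult_mono order_trans)
    then show "exp (- \<bar>\<theta>\<bar>) \<le> exp (- \<theta> * s)" by simp
  qed
  finally show ?thesis
    by (metis exp_gt_zero less_le_trans min.idem)
qed

lemma segment_fourier_unit_nonzero:
  assumes "0 < x" "x < 1" shows "segment_fourier 1 x \<noteq> 0"
proof -
  have "0 < sin x" using assms pi_gt3 by (intro sin_gt_zero) auto
  then have "cis x \<noteq> 1" by (auto simp: complex_eq_iff)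
  then show ?thesis using assms by (simp add: segment_fourier_def)
qed

text \<open>The spectral integrand is nonnegative, and it is positive on the open unit cube: there the symbol is
  positive and no factor of the transform vanishes, because \<open>sin x > 0\<close> for \<open>0 < x < 1\<close>. Integrability
  is essential here, as a divergent integral has the default value \<open>0\<close>.\<close>

lemma spectral_cov_unit_cube_nonzero:
  fixes \<alpha> :: "'n::finite \<Rightarrow> real"
  assumes \<alpha>: "\<And>k. 0 < \<alpha> k" and m: "m < alpha_bar \<alpha>" and C: "0 < C"
  shows "spectral_cov (\<lambda>z. C / stable_symbol \<alpha> z ^ m) \<theta> 1 1 (indicator (D 1)) (indicator (D 1)) \<noteq> 0"
proof
  assume *: "spectral_cov (\<lambda>z. C / stable_symbol \<alpha> z ^ m) \<theta> 1 1 (indicator (D 1)) (indicator (D 1)) = 0"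
  let ?F = "fourier (indicator (D (1 :: real^'n)))"
  let ?g = "\<lambda>z. C / stable_symbol \<alpha> z ^ m * (norm (?F z))\<^sup>2"
  have one: "(1 :: real^'n) \<in> orthant" by (simp add: orthant_def)
  have g: "complex_of_real (C / stable_symbol \<alpha> z ^ m) * ?F z * cnj (?F z) = complex_of_real (?g z)" for z
    by (simp only: of_real_mult complex_norm_square mult.assoc)
  have "integrable lborel (\<lambda>z. complex_of_real (?g z))"
    using integrable_spectral_integrand[OF \<alpha> m one one, of C] unfolding g .
  then have int: "integrable lborel ?g"
    using integrable_Re by fastforce
  have "complex_of_real (integral\<^sup>L lborel ?g) = 0"
    using * exponential_time_integral_pos[of \<theta>] unfolding spectral_cov_def g integral_complex_of_real by simp
  then have "integral\<^sup>L lborel ?g = 0" by simp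
  then have "AE z in lborel. ?g z = 0"
    using C by (subst (asm) integral_nonneg_eq_0_iff_AE[OF int]) (auto simp: stable_symbol_nonneg)
  then have "AE z in lborel. z \<notin> box 0 (1 :: real^'n)"
  proof eventually_elim
    case (elim z)
    show ?case
    proof
      assume "z \<in> box 0 (1 :: real^'n)"
      then have z: "0 < z $ k" "z $ k < 1" for k by (simp_all add: mem_box_cart)
      have "0 < stable_symbol \<alpha> z"
        using z(1) by (intro stable_symbol_pos[of z undefined]) (simp add: less_imp_neq[symmetric])
      moreover have "?F z \<noteq> 0"
        using segment_fourier_unit_nonzero z by (simp add: fourier_indicator_D[OF one])
      ultimately show False using elim C by simp
    qed
  qed
  then have "emeasure lborel (box 0 (1 :: real^'n)) = 0"
    by (subst (asm) AE_iff_measurable[OF _ refl]) auto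
  moreover have "emeasure lborel (box 0 (1 :: real^'n)) = 1"
    by (subst emeasure_lborel_box) (auto simp: Basis_vec_def inner_axis intro!: prod.neutral)
  ultimately show False by simp
qed

section \<open>The covariance in dimension one\<close>

text \<open>Up to a constant, the variance in dimension one of the increment over a segment of length \<open>a\<close>.\<close>

definition cosine_integral :: "real \<Rightarrow> real \<Rightarrow> real" where
  "cosine_integral s a = (\<integral>x. (1 - cos (a * x)) * \<bar>x\<bar> powr (- s - 2) \<partial>lborel)"

text \<open>The numerator \<open>(e^{iax} - 1) (e^{-ibx} - 1)\<close> has real part \<open>cos ((a - b) x) - cos (a x) - cos (b x) + 1\<close>.
  At \<open>x = 0\<close> both sides vanish because \<open>0 powr y = 0\<close>.\<close>

lemma segment_fourier_mult_cnj:
  "Re (segment_fourier a x * cnj (segment_fourier b x)) * \<bar>x\<bar> powr (- s) =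
    (1 - cos (a * x)) * \<bar>x\<bar> powr (- s - 2) + (1 - cos (b * x)) * \<bar>x\<bar> powr (- s - 2) -
    (1 - cos ((a - b) * x)) * \<bar>x\<bar> powr (- s - 2)"
proof (cases "x = 0")
  case False
  have "(\<i> * of_real x) * cnj (\<i> * of_real x) = of_real (x\<^sup>2)"
    by (simp add: complex_eq_iff power2_eq_square)
  then have "segment_fourier a x * cnj (segment_fourier b x) =
      (cis (a * x) - 1) * cnj (cis (b * x) - 1) / of_real (x\<^sup>2)"
    unfolding segment_fourier_def by (simp only: False if_False complex_cnj_divide times_divide_times_eq)
  then have "Re (segment_fourier a x * cnj (segment_fourier b x)) =
      ((1 - cos (a * x)) + (1 - cos (b * x)) - (1 - cos ((a - b) * x))) / x\<^sup>2"
    by (simp add: Re_divide_of_real cos_diff left_diff_distrib algebra_simps del: of_real_power)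
  moreover have "\<bar>x\<bar> powr (- s - 2) = \<bar>x\<bar> powr (- s) / x\<^sup>2"
    using False powr_diff[of "\<bar>x\<bar>" "- s" 2] by (simp add: powr_numeral)
  ultimately show ?thesis
    by (simp only:) (simp add: add_divide_distrib diff_divide_distrib algebra_simps)
qed simp

text \<open>The case \<open>a = b\<close> of the preceding identity reduces this to the square of one transform.\<close>

lemma integrable_one_minus_cos_powr:
  fixes a s :: real
  assumes "s < 1" "0 \<le> s"
  shows "integrable lborel (\<lambda>x. (1 - cos (a * x)) * \<bar>x\<bar> powr (- s - 2))"
proof -
  have "(1 - cos (a * x)) * \<bar>x\<bar> powr (- s - 2) =
      1 / 2 * (\<bar>x\<bar> powr (- s) * (norm (segment_fourier \<bar>a\<bar> x) * norm (segment_fourier \<bar>a\<bar> x)))" for x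
  proof -
    have "cos (\<bar>a\<bar> * x) = cos (a * x)" by (simp add: abs_if)
    moreover have "Re (segment_fourier \<bar>a\<bar> x * cnj (segment_fourier \<bar>a\<bar> x)) =
        norm (segment_fourier \<bar>a\<bar> x) * norm (segment_fourier \<bar>a\<bar> x)"
      by (metis Re_complex_of_real complex_norm_square of_real_power power2_eq_square)
    ultimately show ?thesis
      using segment_fourier_mult_cnj[of "\<bar>a\<bar>" x "\<bar>a\<bar>" s] by (simp add: mult_ac)
  qed
  then show ?thesis
    by (simp only:) (intro integrable_mult_right integrable_powr_segment_fourier assms abs_ge_zero)
qed

lemma cosine_integral_scaling: "cosine_integral s a = \<bar>a\<bar> powr (1 + s) * cosine_integral s 1"
proof (cases "a = 0")
  case False
  have "cosine_integral s 1 = \<bar>a\<bar> * (\<integral>x. (1 - cos (a * x)) * \<bar>a * x\<bar> powr (- s - 2) \<partial>lborel)"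
    unfolding cosine_integral_def
    using lborel_integral_real_affine[OF False, of "\<lambda>x. (1 - cos x) * \<bar>x\<bar> powr (- s - 2)" 0] by simp
  also have "(\<lambda>x. (1 - cos (a * x)) * \<bar>a * x\<bar> powr (- s - 2)) =
      (\<lambda>x. \<bar>a\<bar> powr (- s - 2) * ((1 - cos (a * x)) * \<bar>x\<bar> powr (- s - 2)))"
    by (simp add: abs_mult powr_mult mult_ac fun_eq_iff)
  finally have "cosine_integral s 1 = \<bar>a\<bar> * \<bar>a\<bar> powr (- s - 2) * cosine_integral s a"
    by (simp add: cosine_integral_def)
  moreover have "\<bar>a\<bar> powr (1 + s) * (\<bar>a\<bar> * \<bar>a\<bar> powr (- s - 2)) = 1"
    using False by (simp add: powr_mult_base powr_add[symmetric])
  ultimately show ?thesis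
    by (metis mult.assoc mult_1)
qed (simp add: cosine_integral_def)

text \<open>The covariance of a real field is real, hence equal to the real part of the spectral integral; in
  that part the three cosine terms separate and scale individually.\<close>

lemma spectral_cov_dimension_one:
  fixes \<alpha> :: "'n::finite \<Rightarrow> real"
  assumes UNIV: "UNIV = {k::'n}" and s: "0 < m" "0 < \<alpha> k" "m * \<alpha> k < 1" and u: "0 \<le> u" and v: "0 \<le> v"
  shows "Re (spectral_cov (\<lambda>z::real^'n. C / stable_symbol \<alpha> z ^ m) \<theta> 1 1 (indicator (D (vec u))) (indicator (D (vec v)))) =
    C / (2 * pi) * (LBINT s:{0..min 1 1}. exp (- \<theta> * s)) * cosine_integral (m * \<alpha> k) 1 *
      (u powr (1 + m * \<alpha> k) + v powr (1 + m * \<alpha> k) - \<bar>u - v\<bar> powr (1 + m * \<alpha> k))"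
proof -
  let ?s = "m * \<alpha> k"
  let ?S = "\<lambda>x. (\<bar>x\<bar> powr \<alpha> k) ^ m"
  let ?J = "\<lambda>a x. (1 - cos (a * x)) * \<bar>x\<bar> powr (- ?s - 2)"
  let ?f = "\<lambda>x. complex_of_real (C / ?S x) * segment_fourier u x * cnj (segment_fourier v x)"
  have orth: "vec u \<in> (orthant :: (real^'n) set)" "vec v \<in> (orthant :: (real^'n) set)"
    using u v by (simp_all add: orthant_def)
  have S: "C / ?S x = C * \<bar>x\<bar> powr (- ?s)" for x
  proof (cases "x = 0")
    case False
    then have "?S x = \<bar>x\<bar> powr ?s"
      by (simp add: powr_realpow[symmetric] powr_powr mult.commute)
    then show ?thesis by (simp add: powr_minus_divide)
  qed (use s in simp)
  have card: "CARD('n) = 1" unfolding UNIV by simp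
  have Ref: "Re (?f x) = C * (?J u x + ?J v x - ?J (u - v) x)" for x
  proof -
    have "Re (?f x) = C * (Re (segment_fourier u x * cnj (segment_fourier v x)) * \<bar>x\<bar> powr (- ?s))"
      unfolding S by (simp add: algebra_simps)
    then show ?thesis unfolding segment_fourier_mult_cnj .
  qed
  have int: "integrable lborel ?f"
  proof (rule Bochner_Integration.integrable_bound)
    show "integrable lborel (\<lambda>x. \<bar>C\<bar> * (\<bar>x\<bar> powr (- ?s) * (norm (segment_fourier u x) * norm (segment_fourier v x))))"
      using s u v by (intro integrable_mult_right integrable_powr_segment_fourier) auto
    show "AE x in lborel. norm (?f x) \<le> norm (\<bar>C\<bar> * (\<bar>x\<bar> powr (- ?s) * (norm (segment_fourier u x) * norm (segment_fourier v x))))"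
      unfolding S by (intro AE_I2) (simp add: norm_mult abs_mult)
  qed measurable
  have "(\<integral>z. complex_of_real (C / stable_symbol \<alpha> z ^ m) * fourier (indicator (D (vec u))) z *
      cnj (fourier (indicator (D (vec v))) z) \<partial>(lborel :: (real^'n) measure)) =
      (\<integral>z. (\<Prod>j\<in>UNIV. ?f (z $ j)) \<partial>(lborel :: (real^'n) measure))"
    by (simp add: fourier_indicator_D orth stable_symbol_def UNIV)
  also have "\<dots> = integral\<^sup>L lborel ?f"
    using int by (subst integral_prod_coordinates) (auto simp: UNIV)
  finally have "Re (\<integral>z. complex_of_real (C / stable_symbol \<alpha> z ^ m) * fourier (indicator (D (vec u))) z *
      cnj (fourier (indicator (D (vec v))) z) \<partial>(lborel :: (real^'n) measure)) = Re (integral\<^sup>L lborel ?f)"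
    by simp
  also have "\<dots> = (\<integral>x. Re (?f x) \<partial>lborel)"
    using int by (rule integral_Re[symmetric])
  also have "\<dots> = C * (cosine_integral ?s u + cosine_integral ?s v - cosine_integral ?s (u - v))"
    unfolding Ref cosine_integral_def using s by (simp add: integrable_one_minus_cos_powr)
  also have "\<dots> = C * cosine_integral ?s 1 * (u powr (1 + ?s) + v powr (1 + ?s) - \<bar>u - v\<bar> powr (1 + ?s))"
    unfolding cosine_integral_scaling[of _ u] cosine_integral_scaling[of _ v] cosine_integral_scaling[of _ "u - v"]
    using u v by (simp add: algebra_simps)
  finally have main: "Re (\<integral>z. complex_of_real (C / stable_symbol \<alpha> z ^ m) * fourier (indicator (D (vec u))) z *
      cnj (fourier (indicator (D (vec v))) z) \<partial>(lborel :: (real^'n) measure)) =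
      C * cosine_integral ?s 1 * (u powr (1 + ?s) + v powr (1 + ?s) - \<bar>u - v\<bar> powr (1 + ?s))" .
  have normalisation: "Re (1 / (2 * complex_of_real pi) ^ 1 * I * complex_of_real T) = Re I * T / (2 * pi)" for I T
  proof -
    have "1 / (2 * complex_of_real pi) ^ 1 * I * complex_of_real T = I * of_real (T / (2 * pi))"
      by simp
    then show ?thesis by (simp only:) simp
  qed
  then show ?thesis
    unfolding spectral_cov_def card normalisation main by simp
qed

section \<open>Joint laws are determined by linear combinations\<close>

text \<open>The Cramer-Wold theorem is reduced to the uniqueness theorem for characteristic functions on the line
  by replacing one exponential at a time by an indicator. The other factors act as a weight on the
  probability space.\<close>

context prob_space begin

text \<open>Normalised by its total mass, the weight \<open>F\<close> is a density; the hypothesis says that \<open>U\<close> under this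
  density has the same characteristic function as \<open>V\<close> under the density \<open>G\<close>. The value \<open>t = 0\<close> shows
  that both normalisations agree.\<close>

lemma expectation_indicator_weighted_eq:
  fixes U V F G :: "'a \<Rightarrow> real"
  assumes [measurable]: "random_variable borel U" "random_variable borel V"
      "random_variable borel F" "random_variable borel G"
    and bF: "\<And>\<omega>. 0 \<le> F \<omega> \<and> F \<omega> \<le> b" and bG: "\<And>\<omega>. 0 \<le> G \<omega> \<and> G \<omega> \<le> b"
    and eq: "\<And>t. expectation (\<lambda>\<omega>. F \<omega> *\<^sub>R cis (t * U \<omega>)) = expectation (\<lambda>\<omega>. G \<omega> *\<^sub>R cis (t * V \<omega>))"
    and A[measurable]: "A \<in> sets borel"
  shows "expectation (\<lambda>\<omega>. F \<omega> * indicator A (U \<omega>)) = expectation (\<lambda>\<omega>. G \<omega> * indicator A (V \<omega>))"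
proof -
  have iF: "integrable M F" and iG: "integrable M G"
    using bF bG by (auto intro!: integrable_const_bound[where B=b])
  have "complex_of_real (expectation F) = of_real (expectation G)"
    using eq[of 0] iF iG by (simp add: scaleR_conv_of_real)
  then have FG: "expectation F = expectation G"
    by simp
  define p where "p = expectation F"
  have mass: "expectation F = p" "expectation G = p"
    by (simp_all add: p_def FG)
  have "0 \<le> p" unfolding p_def using bF by (intro integral_nonneg_AE) auto
  show ?thesis
  proof (cases "p = 0")
    case True
    then have "expectation F = 0" "expectation G = 0"
      using mass by simp_all
    then have "AE \<omega> in M. F \<omega> = 0" "AE \<omega> in M. G \<omega> = 0"
      using integral_nonneg_eq_0_iff_AE[OF iF] integral_nonneg_eq_0_iff_AE[OF iG] bF bG by simp_all
    then have "expectation (\<lambda>\<omega>. F \<omega> * indicator A (U \<omega>)) = 0"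
        "expectation (\<lambda>\<omega>. G \<omega> * indicator A (V \<omega>)) = 0"
      by (auto intro!: integral_eq_zero_AE)
    then show ?thesis by simp
  next
    case False
    with \<open>0 \<le> p\<close> have "p > 0" by simp
    define law where "law H X = distr (density M (\<lambda>\<omega>. ennreal (H \<omega> / p))) borel X" for H X :: "'a \<Rightarrow> real"
    have law: "real_distribution (law H X)" "char (law H X) t = expectation (\<lambda>\<omega>. H \<omega> *\<^sub>R cis (t * X \<omega>)) / p"
        "measure (law H X) A = expectation (\<lambda>\<omega>. H \<omega> * indicator A (X \<omega>)) / p"
      if [measurable]: "random_variable borel H" "random_variable borel X"
        and H: "\<And>\<omega>. 0 \<le> H \<omega> \<and> H \<omega> \<le> b" "expectation H = p" for H X :: "'a \<Rightarrow> real" and t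
    proof -
      have iH: "integrable M H"
        using H by (auto intro!: integrable_const_bound[where B=b])
      have H0: "0 \<le> H \<omega> / p" for \<omega> using H \<open>p > 0\<close> by simp
      have "emeasure (density M (\<lambda>\<omega>. ennreal (H \<omega> / p))) (space M) = (\<integral>\<^sup>+\<omega>. ennreal (H \<omega> / p) \<partial>M)"
        by (auto simp: emeasure_density intro!: nn_integral_cong)
      also have "\<dots> = ennreal (expectation (\<lambda>\<omega>. H \<omega> / p))"
        using H0 iH by (intro nn_integral_eq_integral) auto
      also have "\<dots> = 1"
        using H \<open>p > 0\<close> by simp
      finally interpret P: prob_space "density M (\<lambda>\<omega>. ennreal (H \<omega> / p))"
        by (intro prob_spaceI) simp
      show "real_distribution (law H X)"
        unfolding law_def by (rule P.real_distribution_distr) simp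
      interpret L: real_distribution "law H X" by fact
      have "char (law H X) t = (\<integral>\<omega>. (H \<omega> / p) *\<^sub>R cis (t * X \<omega>) \<partial>M)"
        unfolding char_def law_def using H0
        by (simp add: integral_distr integral_density cis_conv_exp)
      also have "\<dots> = expectation (\<lambda>\<omega>. (1 / p) *\<^sub>R (H \<omega> *\<^sub>R cis (t * X \<omega>)))"
        by simp
      also have "\<dots> = expectation (\<lambda>\<omega>. H \<omega> *\<^sub>R cis (t * X \<omega>)) / p"
        by (subst integral_scaleR_right) (simp add: scaleR_conv_of_real)
      finally show "char (law H X) t = expectation (\<lambda>\<omega>. H \<omega> *\<^sub>R cis (t * X \<omega>)) / p" .
      have "measure (law H X) A = (\<integral>x. indicator A x \<partial>law H X)"
        by (simp add: law_def)
      also have "\<dots> = (\<integral>\<omega>. (H \<omega> / p) *\<^sub>R indicator A (X \<omega>) \<partial>M)"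
        unfolding law_def using H0 by (subst integral_distr; simp add: integral_density)
      also have "\<dots> = expectation (\<lambda>\<omega>. H \<omega> * indicator A (X \<omega>)) / p"
        by simp
      finally show "measure (law H X) A = expectation (\<lambda>\<omega>. H \<omega> * indicator A (X \<omega>)) / p" .
    qed
    have "law F U = law G V"
      by (rule Levy_uniqueness) (auto simp: law bF bG mass eq intro!: ext)
    moreover have "measure (law F U) A = expectation (\<lambda>\<omega>. F \<omega> * indicator A (U \<omega>)) / p"
        "measure (law G V) A = expectation (\<lambda>\<omega>. G \<omega> * indicator A (V \<omega>)) / p"
      by (simp_all add: law bF bG mass)
    ultimately have "expectation (\<lambda>\<omega>. F \<omega> * indicator A (U \<omega>)) / p = expectation (\<lambda>\<omega>. G \<omega> * indicator A (V \<omega>)) / p"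
      by metis
    with \<open>p > 0\<close> show ?thesis by simp
  qed
qed

text \<open>By induction on \<open>S\<close>, the expectations of
  \<open>(\<Prod>t\<in>S. indicator (A t) (X t)) * cis (\<Sum>t\<in>J. a t * X t)\<close> agree for all \<open>a\<close>; at \<open>S = J\<close> and \<open>a = 0\<close>
  these are the probabilities of boxes, which generate the product \<sigma>-algebra. A weight has to
  be nonnegative, so the complex exponential is split into real and imaginary part, and each is
  shifted by \<open>1\<close>.\<close>

lemma distr_PiM_eqI_linear_combinations:
  fixes X Y :: "'i \<Rightarrow> 'a \<Rightarrow> real"
  assumes J: "finite J"
    and X[measurable]: "\<And>t. t \<in> J \<Longrightarrow> random_variable borel (X t)"
    and Y[measurable]: "\<And>t. t \<in> J \<Longrightarrow> random_variable borel (Y t)"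
    and eq: "\<And>a. distr M borel (\<lambda>\<omega>. \<Sum>t\<in>J. a t * X t \<omega>) = distr M borel (\<lambda>\<omega>. \<Sum>t\<in>J. a t * Y t \<omega>)"
  shows "distr M (\<Pi>\<^sub>M t\<in>J. borel) (\<lambda>\<omega>. \<lambda>t\<in>J. X t \<omega>) = distr M (\<Pi>\<^sub>M t\<in>J. borel) (\<lambda>\<omega>. \<lambda>t\<in>J. Y t \<omega>)"
proof -
  let ?T = "\<lambda>Z a \<omega>. \<Sum>t\<in>J. a t * Z t \<omega>"
  let ?W = "\<lambda>Z A S \<omega>. \<Prod>t\<in>S. indicator (A t) (Z t \<omega>) :: real"
  have W01: "0 \<le> ?W Z A S \<omega>" "?W Z A S \<omega> \<le> 1" for Z :: "'i \<Rightarrow> 'a \<Rightarrow> real" and A S \<omega>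
    by (auto intro!: prod_nonneg prod_le_1 simp: indicator_def)
  have char_eq: "expectation (\<lambda>\<omega>. ?W X A S \<omega> *\<^sub>R cis (?T X a \<omega>)) = expectation (\<lambda>\<omega>. ?W Y A S \<omega> *\<^sub>R cis (?T Y a \<omega>))"
    if "S \<subseteq> J" and A: "\<And>t. A t \<in> sets borel" for A S a
    using finite_subset[OF \<open>S \<subseteq> J\<close> J] \<open>S \<subseteq> J\<close>
  proof (induction S arbitrary: a rule: finite_induct)
    case empty
    have "expectation (\<lambda>\<omega>. cis (?T X a \<omega>)) = (\<integral>x. cis x \<partial>distr M borel (?T X a))"
      by (subst integral_distr) auto
    also have "\<dots> = expectation (\<lambda>\<omega>. cis (?T Y a \<omega>))"
      unfolding eq by (subst integral_distr) auto
    finally show ?case by simp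
  next
    case (insert j S)
    have "j \<in> J" and SJ: "S \<subseteq> J" using insert.prems by auto
    note [measurable] = X[OF \<open>j \<in> J\<close>] Y[OF \<open>j \<in> J\<close>] A
    have [measurable]: "random_variable borel (?W X A S)" "random_variable borel (?W Y A S)"
      using SJ by (auto intro!: borel_measurable_prod)
    have int: "integrable M (\<lambda>\<omega>. ?W X A S \<omega> *\<^sub>R cis (?T X b \<omega>))"
        "integrable M (\<lambda>\<omega>. ?W Y A S \<omega> *\<^sub>R cis (?T Y b \<omega>))" for b
      using W01 by (auto intro!: integrable_const_bound[where B=1])
    have int': "integrable M (\<lambda>\<omega>. ?W Z A S \<omega> * indicator (A j) (Z j \<omega>) * cos (?T Z a \<omega> + b))"
        "integrable M (\<lambda>\<omega>. ?W Z A S \<omega> * indicator (A j) (Z j \<omega>))"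
      if Z: "\<And>t. t \<in> J \<Longrightarrow> random_variable borel (Z t)" for Z a b
    proof -
      note [measurable] = Z Z[OF \<open>j \<in> J\<close>]
      have [measurable]: "random_variable borel (?W Z A S)"
        using SJ by (auto intro!: borel_measurable_prod)
      have bound: "norm (?W Z A S \<omega> * indicator B x * y) \<le> 1" if "\<bar>y\<bar> \<le> 1" for \<omega> and x y :: real and B
        using that W01[of A Z \<omega> S] by (cases "x \<in> B") (auto simp: abs_mult intro!: mult_le_one)
      show "integrable M (\<lambda>\<omega>. ?W Z A S \<omega> * indicator (A j) (Z j \<omega>) * cos (?T Z a \<omega> + b))"
        by (rule integrable_const_bound[where B=1]) (intro AE_I2 bound, simp, measurable)
      show "integrable M (\<lambda>\<omega>. ?W Z A S \<omega> * indicator (A j) (Z j \<omega>))"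
        using bound[of 1] by (intro integrable_const_bound[where B=1] AE_I2) (simp, measurable)
    qed
    \<comment> \<open>The phase \<open>b\<close> treats both parts at once: \<open>b = 0\<close> gives the cosine and \<open>b = - pi / 2\<close> the sine.
      The weight times \<open>cis (t * X j)\<close> is a combination of three exponentials covered by the induction
      hypothesis.\<close>
    have weighted: "expectation (\<lambda>\<omega>. (?W X A S \<omega> * (1 + cos (?T X a \<omega> + b))) * indicator (A j) (X j \<omega>)) =
        expectation (\<lambda>\<omega>. (?W Y A S \<omega> * (1 + cos (?T Y a \<omega> + b))) * indicator (A j) (Y j \<omega>))" for a b
    proof (rule expectation_indicator_weighted_eq[where b=2])
      fix t :: real
      define e where "e = (\<lambda>s. if s = j then t else 0)"
      have expand: "(?W Z A S \<omega> * (1 + cos (?T Z a \<omega> + b))) *\<^sub>R cis (t * Z j \<omega>) =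
          ?W Z A S \<omega> *\<^sub>R cis (?T Z e \<omega>) +
          cis b / 2 * (?W Z A S \<omega> *\<^sub>R cis (?T Z (\<lambda>s. e s + a s) \<omega>)) +
          cis (- b) / 2 * (?W Z A S \<omega> *\<^sub>R cis (?T Z (\<lambda>s. e s - a s) \<omega>))" for Z :: "'i \<Rightarrow> 'a \<Rightarrow> real" and \<omega>
      proof -
        have e: "?T Z e \<omega> = t * Z j \<omega>"
          using J \<open>j \<in> J\<close> by (simp add: e_def if_distrib[of "\<lambda>x. x * _"] cong: if_cong)
        have T: "?T Z (\<lambda>s. e s + a s) \<omega> = t * Z j \<omega> + ?T Z a \<omega>"
            "?T Z (\<lambda>s. e s - a s) \<omega> = t * Z j \<omega> - ?T Z a \<omega>"
          by (simp_all add: e[symmetric] distrib_right left_diff_distrib sum.distrib sum_subtractf)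
        have "complex_of_real (cos y) = (cis y + cis (- y)) / 2" for y
          by (simp add: complex_eq_iff)
        from this[of "?T Z a \<omega> + b"]
        have "complex_of_real (1 + cos (?T Z a \<omega> + b)) * cis (t * Z j \<omega>) =
            cis (t * Z j \<omega>) + cis b / 2 * cis (t * Z j \<omega> + ?T Z a \<omega>) + cis (- b) / 2 * cis (t * Z j \<omega> - ?T Z a \<omega>)"
          by (simp add: distrib_right cis_mult add_divide_distrib algebra_simps)
        then have "complex_of_real (?W Z A S \<omega>) * (complex_of_real (1 + cos (?T Z a \<omega> + b)) * cis (t * Z j \<omega>)) =
            complex_of_real (?W Z A S \<omega>) * (cis (t * Z j \<omega>) + cis b / 2 * cis (t * Z j \<omega> + ?T Z a \<omega>) + cis (- b) / 2 * cis (t * Z j \<omega> - ?T Z a \<omega>))"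
          by (rule arg_cong)
        then show ?thesis
          unfolding T e scaleR_conv_of_real of_real_mult
          by (simp only: distrib_left mult.assoc mult.left_commute)
      qed
      show "expectation (\<lambda>\<omega>. (?W X A S \<omega> * (1 + cos (?T X a \<omega> + b))) *\<^sub>R cis (t * X j \<omega>)) =
          expectation (\<lambda>\<omega>. (?W Y A S \<omega> * (1 + cos (?T Y a \<omega> + b))) *\<^sub>R cis (t * Y j \<omega>))"
        unfolding expand
        using insert.IH[OF SJ] by (simp only: int Bochner_Integration.integral_add
            Bochner_Integration.integrable_add integrable_mult_right integral_mult_right_zero)
    next
      have "0 \<le> ?W Z A S \<omega> * (1 + cos y) \<and> ?W Z A S \<omega> * (1 + cos y) \<le> 2" for Z :: "'i \<Rightarrow> 'a \<Rightarrow> real" and \<omega> y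
        using W01[of A Z \<omega> S] mult_mono[of "?W Z A S \<omega>" 1 "1 + cos y" 2] cos_ge_minus_one[of y] cos_le_one[of y]
        by (auto intro!: mult_nonneg_nonneg simp del: cos_ge_minus_one)
      then show "0 \<le> ?W X A S \<omega> * (1 + cos (?T X a \<omega> + b)) \<and> ?W X A S \<omega> * (1 + cos (?T X a \<omega> + b)) \<le> 2"
          "0 \<le> ?W Y A S \<omega> * (1 + cos (?T Y a \<omega> + b)) \<and> ?W Y A S \<omega> * (1 + cos (?T Y a \<omega> + b)) \<le> 2" for \<omega>
        by blast+
    qed (use A in measurable)
    \<comment> \<open>With zero coefficients, the phase \<open>pi / 2\<close> annihilates the cosine and leaves the weight \<open>?W\<close>.\<close>
    have mass: "expectation (\<lambda>\<omega>. ?W X A S \<omega> * indicator (A j) (X j \<omega>)) =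
        expectation (\<lambda>\<omega>. ?W Y A S \<omega> * indicator (A j) (Y j \<omega>))"
      using weighted[of "\<lambda>_. 0" "pi / 2"] by simp
    have cosine: "expectation (\<lambda>\<omega>. ?W X A S \<omega> * indicator (A j) (X j \<omega>) * cos (?T X a \<omega> + b)) =
        expectation (\<lambda>\<omega>. ?W Y A S \<omega> * indicator (A j) (Y j \<omega>) * cos (?T Y a \<omega> + b))" for b
    proof -
      have "(?W Z A S \<omega> * (1 + cos (?T Z a \<omega> + b))) * indicator (A j) (Z j \<omega>) =
          ?W Z A S \<omega> * indicator (A j) (Z j \<omega>) + ?W Z A S \<omega> * indicator (A j) (Z j \<omega>) * cos (?T Z a \<omega> + b)" for Z :: "'i \<Rightarrow> 'a \<Rightarrow> real" and \<omega>
        by (simp add: algebra_simps)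
      then show ?thesis
        using weighted[of a b] mass int'[of X, OF X] int'[of Y, OF Y] by simp
    qed
    have split: "?W Z A (insert j S) \<omega> *\<^sub>R cis (?T Z a \<omega>) =
        complex_of_real (?W Z A S \<omega> * indicator (A j) (Z j \<omega>) * cos (?T Z a \<omega> + 0)) +
        \<i> * complex_of_real (?W Z A S \<omega> * indicator (A j) (Z j \<omega>) * cos (?T Z a \<omega> + (- pi / 2)))" for Z :: "'i \<Rightarrow> 'a \<Rightarrow> real" and \<omega>
      using insert.hyps by (simp add: complex_eq_iff cos_diff mult.commute del: of_real_prod)
    show ?case
      unfolding split
      by (subst (1 2) Bochner_Integration.integral_add)
        (simp_all only: int'[of X, OF X] int'[of Y, OF Y] cosine integrable_of_real integrable_mult_right integral_mult_right_zero
          integral_complex_of_real)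
  qed
  show ?thesis
  proof (rule measure_eqI_PiM_finite)
    let ?P = "distr M (\<Pi>\<^sub>M t\<in>J. borel) (\<lambda>\<omega>. \<lambda>t\<in>J. X t \<omega>)"
    show "finite J" by fact
    fix A :: "'i \<Rightarrow> real set" assume A: "\<And>t. t \<in> J \<Longrightarrow> A t \<in> sets borel"
    \<comment> \<open>The induction takes sets \<open>A t\<close> that are measurable for every index, also outside \<open>J\<close>.\<close>
    define B where "B t = (if t \<in> J then A t else {})" for t
    have B[measurable]: "B t \<in> sets borel" for t using A by (simp add: B_def)
    have box: "emeasure (distr M (\<Pi>\<^sub>M t\<in>J. borel) (\<lambda>\<omega>. \<lambda>t\<in>J. Z t \<omega>)) (Pi\<^sub>E J A) = ennreal (expectation (?W Z B J))"
      if [measurable]: "\<And>t. t \<in> J \<Longrightarrow> random_variable borel (Z t)" for Z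
    proof -
      define S where "S = {\<omega>\<in>space M. \<forall>t\<in>J. Z t \<omega> \<in> B t}"
      have [measurable]: "S \<in> events" unfolding S_def using J by measurable
      have PiA: "Pi\<^sub>E J A \<in> sets (\<Pi>\<^sub>M t\<in>J. borel)" using A J by (intro sets_PiM_I_finite) auto
      have "emeasure (distr M (\<Pi>\<^sub>M t\<in>J. borel) (\<lambda>\<omega>. \<lambda>t\<in>J. Z t \<omega>)) (Pi\<^sub>E J A) = emeasure M S"
        using PiA by (subst emeasure_distr) (auto intro!: arg_cong[where f="emeasure M"] simp: S_def B_def)
      also have "\<dots> = ennreal (expectation (indicator S))"
        by (simp add: emeasure_eq_measure)
      also have "expectation (indicator S) = expectation (?W Z B J)"
      proof (intro Bochner_Integration.integral_cong refl)
        fix \<omega> assume "\<omega> \<in> space M"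
        show "indicator S \<omega> = ?W Z B J \<omega>"
        proof (cases "\<omega> \<in> S")
          case False
          with \<open>\<omega> \<in> space M\<close> obtain t where "t \<in> J" "Z t \<omega> \<notin> B t" by (auto simp: S_def)
          then have "?W Z B J \<omega> = 0" using J by (intro prod_zero) (auto simp: indicator_def)
          with False show ?thesis by simp
        qed (simp add: S_def)
      qed
      finally show ?thesis .
    qed
    have "expectation (?W Z B J) = Re (expectation (\<lambda>\<omega>. ?W Z B J \<omega> *\<^sub>R cis (?T Z (\<lambda>_. 0) \<omega>)))" for Z :: "'i \<Rightarrow> 'a \<Rightarrow> real"
      by (simp add: scaleR_conv_of_real del: of_real_prod)
    then show "emeasure ?P (Pi\<^sub>E J A) = emeasure (distr M (\<Pi>\<^sub>M t\<in>J. borel) (\<lambda>\<omega>. \<lambda>t\<in>J. Y t \<omega>)) (Pi\<^sub>E J A)"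
      using char_eq[of J B "\<lambda>_. 0"] B X Y by (simp add: box)
  next
    interpret P: prob_space "distr M (\<Pi>\<^sub>M t\<in>J. borel) (\<lambda>\<omega>. \<lambda>t\<in>J. X t \<omega>)"
      by (rule prob_space_distr) simp
    show "range (\<lambda>_::nat. Pi\<^sub>E J (\<lambda>_. UNIV)) \<subseteq> prod_algebra J (\<lambda>_. borel :: real measure)"
      using J by (auto intro!: prod_algebraI_finite)
    show "(\<Union>i::nat. Pi\<^sub>E J (\<lambda>_. UNIV)) = space (\<Pi>\<^sub>M t\<in>J. (borel :: real measure))"
      by (simp add: space_PiM)
    show "emeasure (distr M (\<Pi>\<^sub>M t\<in>J. borel) (\<lambda>\<omega>. \<lambda>t\<in>J. X t \<omega>)) (Pi\<^sub>E J (\<lambda>_. UNIV)) \<noteq> \<infinity>" for i :: nat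
      by simp
  qed simp_all
qed

end

section \<open>Gaussian fields are determined by their covariances\<close>

lemma normal_density_has_moments:
  assumes "prob_space M" "\<sigma> > 0" and X: "distributed M lborel X (normal_density \<mu> \<sigma>)"
  shows "integrable M X" and "integrable M (\<lambda>\<omega>. (X \<omega>)\<^sup>2)"
    and "integral\<^sup>L M X = \<mu>" and "integral\<^sup>L M (\<lambda>\<omega>. (X \<omega>)\<^sup>2) = \<mu>\<^sup>2 + \<sigma>\<^sup>2"
proof -
  interpret prob_space M by fact
  show 1: "integrable M X"
    using distributed_integrable[OF X, of "\<lambda>x. x"] integrable_normal_moment_nz_1[OF \<open>\<sigma> > 0\<close>, of \<mu>] by simp
  show 2: "integral\<^sup>L M X = \<mu>"
    using normal_distributed_expectation[OF \<open>\<sigma> > 0\<close> X] .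
  have 3: "integrable M (\<lambda>\<omega>. (X \<omega> - \<mu>)\<^sup>2)"
    using distributed_integrable[OF X, of "\<lambda>x. (x - \<mu>)\<^sup>2"] integrable_normal_moment[OF \<open>\<sigma> > 0\<close>, of \<mu> 2] by simp
  have 4: "(X \<omega>)\<^sup>2 = (X \<omega> - \<mu>)\<^sup>2 + 2 * \<mu> * X \<omega> - \<mu>\<^sup>2" for \<omega>
    by (simp add: power2_eq_square algebra_simps)
  show "integrable M (\<lambda>\<omega>. (X \<omega>)\<^sup>2)"
    unfolding 4 using 1 3 by simp
  have "expectation (\<lambda>\<omega>. (X \<omega> - \<mu>)\<^sup>2) = \<sigma>\<^sup>2"
    using normal_distributed_variance[OF \<open>\<sigma> > 0\<close> X] 2 by simp
  then show "expectation (\<lambda>\<omega>. (X \<omega>)\<^sup>2) = \<mu>\<^sup>2 + \<sigma>\<^sup>2"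
    unfolding 4 using 1 2 3 by (simp add: prob_space power2_eq_square)
qed

lemma gaussian_rv_square_integrable:
  assumes "prob_space M" "gaussian_rv M X"
  shows "integrable M (\<lambda>\<omega>. (X \<omega>)\<^sup>2)" and "integrable M X"
proof -
  interpret prob_space M by fact
  have [measurable]: "X \<in> borel_measurable M" using assms(2) by (simp add: gaussian_rv_def)
  consider \<mu> where "AE \<omega> in M. X \<omega> = \<mu>" | \<mu> \<sigma> where "\<sigma> > 0" "distributed M lborel X (normal_density \<mu> \<sigma>)"
    using assms(2) by (auto simp: gaussian_rv_def)
  then have "integrable M (\<lambda>\<omega>. (X \<omega>)\<^sup>2) \<and> integrable M X"
  proof cases
    case 1
    then have "AE \<omega> in M. norm (X \<omega>) \<le> \<bar>\<mu>\<bar>" "AE \<omega> in M. norm ((X \<omega>)\<^sup>2) \<le> \<mu>\<^sup>2" by auto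
    then show ?thesis
      by (intro conjI integrable_const_bound[of _ "\<mu>\<^sup>2"] integrable_const_bound[of X "\<bar>\<mu>\<bar>"]) simp_all
  next
    case 2
    from normal_density_has_moments[OF assms(1) this] show ?thesis by simp
  qed
  then show "integrable M (\<lambda>\<omega>. (X \<omega>)\<^sup>2)" and "integrable M X" by auto
qed

text \<open>A vanishing variance selects the degenerate alternative in the definition of a Gaussian variable and
  a positive one selects the density, whose parameters are then the mean and the variance.\<close>

lemma gaussian_rv_distr_eqI:
  assumes "prob_space M" and X: "gaussian_rv M X" and Y: "gaussian_rv M Y"
    and "integral\<^sup>L M X = 0" "integral\<^sup>L M Y = 0"
    and eq: "integral\<^sup>L M (\<lambda>\<omega>. (X \<omega>)\<^sup>2) = integral\<^sup>L M (\<lambda>\<omega>. (Y \<omega>)\<^sup>2)"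
  shows "distr M borel X = distr M borel Y"
proof -
  interpret prob_space M by fact
  have [measurable]: "X \<in> borel_measurable M" "Y \<in> borel_measurable M"
    using X Y by (simp_all add: gaussian_rv_def)
  define v where "v = integral\<^sup>L M (\<lambda>\<omega>. (X \<omega>)\<^sup>2)"
  have law: "(v = 0 \<and> (AE \<omega> in M. Z \<omega> = 0)) \<or>
      (v \<noteq> 0 \<and> distr M borel Z = density lborel (normal_density 0 (sqrt v)))"
    if Z: "gaussian_rv M Z" "integral\<^sup>L M Z = 0" "integral\<^sup>L M (\<lambda>\<omega>. (Z \<omega>)\<^sup>2) = v" for Z
  proof -
    have [measurable]: "Z \<in> borel_measurable M" using Z by (simp add: gaussian_rv_def)
    consider \<mu> where "AE \<omega> in M. Z \<omega> = \<mu>" | \<mu> \<sigma> where "\<sigma> > 0" "distributed M lborel Z (normal_density \<mu> \<sigma>)"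
      using Z by (auto simp: gaussian_rv_def)
    then show ?thesis
    proof cases
      case 1
      then have "integral\<^sup>L M Z = (\<integral>\<omega>. \<mu> \<partial>M)" by (intro integral_cong_AE) auto
      then have "\<mu> = 0" using Z by (simp add: prob_space)
      with 1 have "AE \<omega> in M. Z \<omega> = 0" by simp
      moreover from this have "integral\<^sup>L M (\<lambda>\<omega>. (Z \<omega>)\<^sup>2) = 0" by (intro integral_eq_zero_AE) auto
      ultimately show ?thesis using Z by simp
    next
      case 2
      note moments = normal_density_has_moments[OF assms(1) 2]
      have "\<mu> = 0" "v = \<sigma>\<^sup>2" using moments Z by auto
      then show ?thesis
        using 2 distributed_distr_eq_density[OF 2(2)] by (simp cong: distr_cong)
    qed
  qed
  show ?thesis
  proof (cases "v = 0")
    case True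
    with law[of X] law[of Y] X Y assms(4,5) eq have "AE \<omega> in M. X \<omega> = 0" "AE \<omega> in M. Y \<omega> = 0"
      by (auto simp: v_def)
    then have "AE \<omega> in M. X \<omega> = Y \<omega>" by auto
    then show ?thesis by (intro distr_cong_AE) auto
  next
    case False
    with law[of X] law[of Y] X Y assms(4,5) eq show ?thesis by (simp add: v_def)
  qed
qed

text \<open>Values of a Gaussian field are linear combinations with one term; products of two values are
  integrable because both are square integrable.\<close>

lemma centered_gaussian_field_integrable:
  assumes "prob_space M" and Y: "centered_gaussian_field M T Y"
  shows "t \<in> T \<Longrightarrow> Y t \<in> borel_measurable M"
    and "t \<in> T \<Longrightarrow> integrable M (Y t)"
    and "s \<in> T \<Longrightarrow> t \<in> T \<Longrightarrow> integrable M (\<lambda>\<omega>. Y s \<omega> * Y t \<omega>)"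
proof -
  interpret prob_space M by fact
  have G: "gaussian_rv M (Y t)" if "t \<in> T" for t
  proof -
    have "\<forall>J a. finite J \<and> J \<subseteq> T \<longrightarrow> gaussian_rv M (\<lambda>\<omega>. \<Sum>t\<in>J. a t * Y t \<omega>)"
      using Y by (simp add: centered_gaussian_field_def)
    from this[rule_format, of "{t}" "\<lambda>_. 1"] that have "gaussian_rv M (\<lambda>\<omega>. \<Sum>s\<in>{t}. 1 * Y s \<omega>)"
      by simp
    then show ?thesis by simp
  qed
  show m: "t \<in> T \<Longrightarrow> Y t \<in> borel_measurable M" for t
    using G by (simp add: gaussian_rv_def)
  show "t \<in> T \<Longrightarrow> integrable M (Y t)"
    using gaussian_rv_square_integrable[OF assms(1) G] by blast
  assume "s \<in> T" "t \<in> T"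
  note [measurable] = m[OF \<open>s \<in> T\<close>] m[OF \<open>t \<in> T\<close>]
  have "integrable M (\<lambda>\<omega>. (Y s \<omega>)\<^sup>2 + (Y t \<omega>)\<^sup>2)"
    using gaussian_rv_square_integrable(1)[OF assms(1) G] \<open>s \<in> T\<close> \<open>t \<in> T\<close> by simp
  then show "integrable M (\<lambda>\<omega>. Y s \<omega> * Y t \<omega>)"
  proof (rule Bochner_Integration.integrable_bound)
    have "\<bar>a * b\<bar> \<le> a\<^sup>2 + b\<^sup>2" for a b :: real
      using sum_squares_bound[of "\<bar>a\<bar>" "\<bar>b\<bar>"] abs_ge_zero[of "a * b"] unfolding abs_mult power2_abs by linarith
    then show "AE \<omega> in M. norm (Y s \<omega> * Y t \<omega>) \<le> norm ((Y s \<omega>)\<^sup>2 + (Y t \<omega>)\<^sup>2)"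
      by simp
  qed measurable
qed

lemma same_fdd_of_covariance_eq:
  assumes "prob_space M" and X: "centered_gaussian_field M T X" and Y: "centered_gaussian_field M T Y"
    and cov: "\<And>s t. s \<in> T \<Longrightarrow> t \<in> T \<Longrightarrow>
      integral\<^sup>L M (\<lambda>\<omega>. X s \<omega> * X t \<omega>) = integral\<^sup>L M (\<lambda>\<omega>. Y s \<omega> * Y t \<omega>)"
  shows "same_fdd M T X Y"
  unfolding same_fdd_def
proof (intro allI impI)
  interpret prob_space M by fact
  fix J assume J: "finite J \<and> J \<subseteq> T"
  then have JT: "t \<in> T" if "t \<in> J" for t using that by auto
  show "distr M (\<Pi>\<^sub>M t\<in>J. borel) (\<lambda>\<omega>. \<lambda>t\<in>J. X t \<omega>) = distr M (\<Pi>\<^sub>M t\<in>J. borel) (\<lambda>\<omega>. \<lambda>t\<in>J. Y t \<omega>)"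
  proof (rule distr_PiM_eqI_linear_combinations)
    fix a :: "_ \<Rightarrow> real"
    have mean: "integral\<^sup>L M (\<lambda>\<omega>. \<Sum>t\<in>J. a t * Z t \<omega>) = 0"
      and var: "integral\<^sup>L M (\<lambda>\<omega>. (\<Sum>t\<in>J. a t * Z t \<omega>)\<^sup>2) =
          (\<Sum>s\<in>J. \<Sum>t\<in>J. a s * a t * integral\<^sup>L M (\<lambda>\<omega>. Z s \<omega> * Z t \<omega>))"
      if Z: "centered_gaussian_field M T Z" for Z
    proof -
      note ZI = centered_gaussian_field_integrable[OF assms(1) Z]
      have Z0: "integral\<^sup>L M (Z t) = 0" if "t \<in> J" for t
        using Z JT[OF that] by (simp add: centered_gaussian_field_def)
      show "integral\<^sup>L M (\<lambda>\<omega>. \<Sum>t\<in>J. a t * Z t \<omega>) = 0"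
        using ZI JT Z0 by (subst Bochner_Integration.integral_sum) auto
      have "(\<Sum>t\<in>J. a t * Z t \<omega>)\<^sup>2 = (\<Sum>s\<in>J. \<Sum>t\<in>J. a s * a t * (Z s \<omega> * Z t \<omega>))" for \<omega>
        by (simp add: power2_eq_square sum_product mult_ac)
      then show "integral\<^sup>L M (\<lambda>\<omega>. (\<Sum>t\<in>J. a t * Z t \<omega>)\<^sup>2) =
          (\<Sum>s\<in>J. \<Sum>t\<in>J. a s * a t * integral\<^sup>L M (\<lambda>\<omega>. Z s \<omega> * Z t \<omega>))"
        using ZI JT by (simp add: Bochner_Integration.integral_sum Bochner_Integration.integrable_sum)
    qed
    show "distr M borel (\<lambda>\<omega>. \<Sum>t\<in>J. a t * X t \<omega>) = distr M borel (\<lambda>\<omega>. \<Sum>t\<in>J. a t * Y t \<omega>)"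
    proof (rule gaussian_rv_distr_eqI[OF assms(1)])
      show "gaussian_rv M (\<lambda>\<omega>. \<Sum>t\<in>J. a t * X t \<omega>)" "gaussian_rv M (\<lambda>\<omega>. \<Sum>t\<in>J. a t * Y t \<omega>)"
        using X Y J by (simp_all add: centered_gaussian_field_def)
      show "expectation (\<lambda>\<omega>. (\<Sum>t\<in>J. a t * X t \<omega>)\<^sup>2) = expectation (\<lambda>\<omega>. (\<Sum>t\<in>J. a t * Y t \<omega>)\<^sup>2)"
        using cov JT by (simp add: var X Y)
    qed (simp_all add: mean X Y)
  qed (use J JT centered_gaussian_field_integrable(1)[OF assms(1) X] centered_gaussian_field_integrable(1)[OF assms(1) Y] in auto)
qed

text \<open>Injectivity of \<open>f\<close> lets a linear combination over \<open>S\<close> be read as one over \<open>T\<close>: no two terms have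
  to be merged.\<close>

lemma centered_gaussian_field_rescale_reindex:
  assumes Y: "centered_gaussian_field M T Y" and "inj_on f S" "f ` S \<subseteq> T"
  shows "centered_gaussian_field M S (\<lambda>t \<omega>. c * Y (f t) \<omega>)"
  unfolding centered_gaussian_field_def
proof (intro conjI allI impI ballI)
  fix J and a :: "_ \<Rightarrow> real" assume J: "finite J \<and> J \<subseteq> S"
  then have inj: "inj_on f J" using assms(2) by (auto intro: inj_on_subset)
  have "gaussian_rv M (\<lambda>\<omega>. \<Sum>t\<in>f ` J. (a (the_inv_into J f t) * c) * Y t \<omega>)"
    using Y J assms(3) unfolding centered_gaussian_field_def by (meson finite_imageI image_mono order_trans)
  moreover have "(\<Sum>t\<in>f ` J. (a (the_inv_into J f t) * c) * Y t \<omega>) = (\<Sum>t\<in>J. a t * (c * Y (f t) \<omega>))" for \<omega>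
    by (simp add: sum.reindex[OF inj] the_inv_into_f_f[OF inj] mult.assoc cong: sum.cong)
  ultimately show "gaussian_rv M (\<lambda>\<omega>. \<Sum>t\<in>J. a t * (c * Y (f t) \<omega>))" by simp
next
  fix t assume "t \<in> S"
  then show "integral\<^sup>L M (\<lambda>\<omega>. c * Y (f t) \<omega>) = 0"
    using Y assms(3) by (auto simp: centered_gaussian_field_def)
qed

section \<open>Powers and eigenvalues of diagonal operators\<close>

lemma matrix_diag_vector_mult: "(c *\<^sub>R diag_matrix a) *v x = (\<chi> k. c * a k * x $ k)"
  by (simp add: matrix_vector_mult_def diag_matrix_def vec_eq_iff if_distrib[of "\<lambda>y. y * _"]
      if_distrib[of "\<lambda>y. _ * y"] cong: if_cong)

lemma op_powr_diag:
  assumes "0 < c"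
  shows "op_powr c ((*v) (s *\<^sub>R diag_matrix a)) x = (\<chi> k. c powr (s * a k) * x $ k)"
proof -
  let ?E = "(*v) (s *\<^sub>R diag_matrix a)"
  have pow: "(?E ^^ n) x = (\<chi> k. (s * a k) ^ n * x $ k)" for n
    by (induction n) (simp_all add: matrix_diag_vector_mult mult_ac)
  have "(\<lambda>n. (ln c ^ n / fact n) *\<^sub>R (?E ^^ n) x) sums (\<chi> k. c powr (s * a k) * x $ k)"
    unfolding sums_def
  proof (rule vec_tendstoI)
    fix k
    have "(\<lambda>n. (s * a k * ln c) ^ n /\<^sub>R fact n * x $ k) sums (exp (s * a k * ln c) * x $ k)"
      by (intro sums_mult2 exp_converges)
    then have "(\<lambda>n. ln c ^ n / fact n * ((s * a k) ^ n * x $ k)) sums (c powr (s * a k) * x $ k)"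
      using assms by (simp add: powr_def power_mult_distrib field_simps)
    then show "(\<lambda>N. (\<Sum>n<N. (ln c ^ n / fact n) *\<^sub>R (?E ^^ n) x) $ k) \<longlonglongrightarrow> (\<chi> k. c powr (s * a k) * x $ k) $ k"
      by (simp add: sums_def pow sum_component)
  qed
  then show ?thesis
    unfolding op_powr_def by (rule sums_unique[symmetric])
qed

lemma complex_eigenvalue_diag:
  assumes "complex_eigenvalue ((*v) (s *\<^sub>R diag_matrix a :: real^'n^'n)) l"
  shows "\<exists>k. l = of_real (s * a k)"
proof -
  obtain v :: "complex^'n" where "v \<noteq> 0"
    and v: "(\<chi> i j. complex_of_real ((s *\<^sub>R diag_matrix a :: real^'n^'n) $ i $ j)) *v v = l *s v"
    using assms by (auto simp: complex_eigenvalue_def)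
  then obtain k where k: "v $ k \<noteq> 0" by (auto simp: vec_eq_iff)
  have "of_real (s * a k) * v $ k = l * v $ k"
    using arg_cong[OF v, of "\<lambda>w. w $ k"]
    by (simp add: matrix_vector_mult_def diag_matrix_def if_distrib[of "\<lambda>y. y * _"]
        if_distrib[of "\<lambda>y. _ * y"] if_distrib[of complex_of_real] cong: if_cong)
  with k show ?thesis by auto
qed

section \<open>Gaussian fields whose spectral density is a power of the symbol\<close>

text \<open>The common part of the two fields of the theorem, which are the cases \<open>C = 2\<close>, \<open>m = 1\<close> and
  \<open>C = \<gamma>\<close>, \<open>m = 2\<close>.\<close>

locale power_spectrum_field = prob_space M for M :: "'w measure" +
  fixes Y :: "real^'n \<Rightarrow> 'w \<Rightarrow> real" and \<alpha> :: "'n::finite \<Rightarrow> real" and C \<theta> :: real and m :: nat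
  assumes \<alpha>_pos: "\<And>k. 0 < \<alpha> k" and C_pos: "0 < C" and m_pos: "0 < m" and m_less: "m < alpha_bar \<alpha>"
    and field: "occupation_field M (\<lambda>z. C / stable_symbol \<alpha> z ^ m) \<theta> Y"
begin

abbreviation cov :: "real^'n \<Rightarrow> real^'n \<Rightarrow> complex" where
  "cov u v \<equiv> spectral_cov (\<lambda>z. C / stable_symbol \<alpha> z ^ m) \<theta> 1 1 (indicator (D u)) (indicator (D v))"

lemma gaussian: "centered_gaussian_field M orthant Y"
  using field by (simp add: occupation_field_def)

lemma expectation_product:
  assumes "u \<in> orthant" "v \<in> orthant"
  shows "complex_of_real (expectation (\<lambda>\<omega>. Y u \<omega> * Y v \<omega>)) = cov u v"
  using field assms by (simp add: occupation_field_def)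

lemma vanishes_on_faces:
  assumes "u \<in> orthant" "u $ k = 0"
  shows "AE \<omega> in M. Y u \<omega> = 0"
proof -
  have "complex_of_real (expectation (\<lambda>\<omega>. Y u \<omega> * Y u \<omega>)) = 0"
    using expectation_product[OF assms(1) assms(1)] spectral_cov_null_box[OF assms] by simp
  then have "expectation (\<lambda>\<omega>. Y u \<omega> * Y u \<omega>) = 0" by simp
  then have "AE \<omega> in M. Y u \<omega> * Y u \<omega> = 0"
    using centered_gaussian_field_integrable(3)[OF prob_space_axioms gaussian assms(1) assms(1)]
    by (subst (asm) integral_nonneg_eq_0_iff_AE) auto
  then show ?thesis by simp
qed

lemma unit_cube_variance_pos: "0 < expectation (\<lambda>\<omega>. Y 1 \<omega> * Y 1 \<omega>)"
proof -
  have one: "(1 :: real^'n) \<in> orthant" by (simp add: orthant_def)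
  have "complex_of_real (expectation (\<lambda>\<omega>. Y 1 \<omega> * Y 1 \<omega>)) \<noteq> 0"
    unfolding expectation_product[OF one one]
    by (rule spectral_cov_unit_cube_nonzero[OF \<alpha>_pos m_less C_pos])
  moreover have "0 \<le> expectation (\<lambda>\<omega>. Y 1 \<omega> * Y 1 \<omega>)"
    by (intro integral_nonneg_AE) simp
  ultimately show ?thesis by (simp add: less_le)
qed

text \<open>The points \<open>u = axis i 1\<close> and \<open>h = 1 - u\<close> both lie on faces of the orthant, as there is a second
  coordinate \<open>j\<close>. Stationarity would equate the law of \<open>Y 1 - Y h = Y 1\<close> with that of \<open>Y u - Y 0 = 0\<close>.\<close>

lemma not_stationary_increments:
  assumes "CARD('n) \<ge> 2"
  shows "\<not> stationary_increments M orthant Y"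
proof
  assume stat: "stationary_increments M orthant Y"
  obtain i j :: 'n where "i \<noteq> j"
    using assms card_le_Suc0_iff_eq[of "UNIV :: 'n set"] by auto
  define u :: "real^'n" where "u = axis i 1"
  define h :: "real^'n" where "h = 1 - axis i 1"
  have u: "u \<in> orthant" and u0: "u $ j = 0"
    using \<open>i \<noteq> j\<close> by (simp_all add: u_def orthant_def axis_def)
  have h: "h \<in> orthant" and h0: "h $ i = 0"
    by (simp_all add: h_def orthant_def axis_def)
  have uh: "u + h = 1" by (simp add: u_def h_def)
  have one: "(1 :: real^'n) \<in> orthant" by (simp add: orthant_def)
  have zero: "(0 :: real^'n) \<in> orthant" by (simp add: orthant_def)
  note meas = centered_gaussian_field_integrable(1)[OF prob_space_axioms gaussian]
  note [measurable] = meas[OF u] meas[OF h] meas[OF one] meas[OF zero]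
  have law: "distr M (\<Pi>\<^sub>M t\<in>{u}. borel) (\<lambda>\<omega>. \<lambda>t\<in>{u}. Y (t + h) \<omega> - Y h \<omega>) =
      distr M (\<Pi>\<^sub>M t\<in>{u}. borel) (\<lambda>\<omega>. \<lambda>t\<in>{u}. Y t \<omega> - Y 0 \<omega>)" (is "?L = ?R")
    using stat h u unfolding stationary_increments_def same_fdd_def by simp
  have [measurable]: "(\<lambda>\<omega>. \<lambda>t\<in>{u}. Y (t + h) \<omega> - Y h \<omega>) \<in> M \<rightarrow>\<^sub>M (\<Pi>\<^sub>M t\<in>{u}. borel)"
      "(\<lambda>\<omega>. \<lambda>t\<in>{u}. Y t \<omega> - Y 0 \<omega>) \<in> M \<rightarrow>\<^sub>M (\<Pi>\<^sub>M t\<in>{u}. borel)"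
    by (auto intro!: measurable_restrict simp: uh)
  have "AE f in ?R. f u = 0"
    using vanishes_on_faces[OF u u0] vanishes_on_faces[OF zero, of i]
    by (subst AE_distr_iff) auto
  then have "AE f in ?L. f u = 0"
    unfolding law .
  then have "AE \<omega> in M. Y (u + h) \<omega> - Y h \<omega> = 0"
    by (subst (asm) AE_distr_iff) auto
  then have "AE \<omega> in M. Y 1 \<omega> = 0"
    using vanishes_on_faces[OF h h0] unfolding uh by eventually_elim simp
  then have "expectation (\<lambda>\<omega>. Y 1 \<omega> * Y 1 \<omega>) = 0"
    by (intro integral_eq_zero_AE) auto
  with unit_cube_variance_pos show False by simp
qed

text \<open>The factor \<open>c powr s\<close> gained by the symbol enters the covariance with the power \<open>m\<close>, and the
  determinant of \<open>c\<^sup>E\<close> contributes \<open>c powr (s * alpha_bar \<alpha>)\<close>. The exponent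
  \<open>s = 2 / (m + alpha_bar \<alpha>)\<close> is the one for which their product is \<open>c\<^sup>2\<close>.\<close>

lemma operator_scaling_inverse_indices:
  "operator_scaling M orthant ((*v) ((2 / (m + alpha_bar \<alpha>)) *\<^sub>R diag_matrix (\<lambda>k. 1 / \<alpha> k))) Y"
proof -
  let ?s = "2 / (m + alpha_bar \<alpha>)"
  let ?E = "(*v) (?s *\<^sub>R diag_matrix (\<lambda>k. 1 / \<alpha> k)) :: real^'n \<Rightarrow> real^'n"
  have b: "0 < alpha_bar \<alpha>" using alpha_bar_pos \<alpha>_pos by blast
  then have s: "0 < ?s" by (simp add: add_nonneg_pos)
  have eigen: "0 < Re l" if l: "complex_eigenvalue ?E l" for l
  proof -
    from complex_eigenvalue_diag[OF l] obtain k where "l = of_real (?s * (1 / \<alpha> k))" ..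
    moreover have "0 < ?s * (1 / \<alpha> k)"
      by (rule mult_pos_pos[OF s]) (simp add: \<alpha>_pos)
    ultimately show ?thesis by (simp only: Re_complex_of_real)
  qed
  have maps: "op_powr c ?E ` orthant \<subseteq> orthant" if "0 < c" for c
    by (auto simp: op_powr_diag[OF that] orthant_def)
  have law: "same_fdd M orthant (\<lambda>t. Y (op_powr c ?E t)) (\<lambda>t \<omega>. c * Y t \<omega>)" if c: "0 < c" for c
  proof (rule same_fdd_of_covariance_eq[OF prob_space_axioms])
    define d where "d k = c powr (?s * (1 / \<alpha> k))" for k
    have d: "0 < d k" for k using c by (simp add: d_def)
    have op: "op_powr c ?E t = (\<chi> k. d k * t $ k)" for t
      by (simp add: op_powr_diag[OF c] d_def)
    have "inj_on (op_powr c ?E) orthant"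
      using d by (auto simp: inj_on_def op vec_eq_iff less_imp_neq[symmetric])
    from centered_gaussian_field_rescale_reindex[OF gaussian this maps[OF c], of 1]
    show "centered_gaussian_field M orthant (\<lambda>t. Y (op_powr c ?E t))" by simp
    show "centered_gaussian_field M orthant (\<lambda>t \<omega>. c * Y t \<omega>)"
      using centered_gaussian_field_rescale_reindex[OF gaussian, of "\<lambda>t. t" orthant c] by simp
    fix u v :: "real^'n" assume u: "u \<in> orthant" and v: "v \<in> orthant"
    define q where "q = (c powr ?s) ^ m"
    have symbol: "stable_symbol \<alpha> (\<chi> k. d k * z $ k) = c powr ?s * stable_symbol \<alpha> z" for z
    proof -
      have "\<bar>d k * z $ k\<bar> powr \<alpha> k = c powr ?s * \<bar>z $ k\<bar> powr \<alpha> k" for k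
        using \<alpha>_pos[of k] by (simp add: d_def abs_mult powr_mult powr_powr)
      then show ?thesis by (simp add: stable_symbol_def sum_distrib_left)
    qed
    have density: "C / stable_symbol \<alpha> z ^ m = q * (C / stable_symbol \<alpha> (\<chi> k. d k * z $ k) ^ m)" for z
      unfolding symbol using c by (simp add: q_def power_mult_distrib)
    have "q * (\<Prod>k\<in>UNIV. d k) = c powr (?s * m) * c powr (?s * alpha_bar \<alpha>)"
      using c by (simp add: q_def d_def powr_realpow[symmetric] powr_powr powr_sum[symmetric]
          alpha_bar_def sum_distrib_left)
    also have "\<dots> = c powr 2"
    proof -
      have "?s * m + ?s * alpha_bar \<alpha> = ?s * (m + alpha_bar \<alpha>)" by (simp only: distrib_left)
      also have "\<dots> = 2" using s by (simp add: field_simps)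
      finally show ?thesis by (simp only: powr_add[symmetric])
    qed
    finally have scale: "q * (\<Prod>k\<in>UNIV. d k) = c\<^sup>2"
      using c by (simp add: powr_numeral)
    have meas: "(\<lambda>z. C / stable_symbol \<alpha> z ^ m) \<in> borel_measurable borel" by measurable
    have "complex_of_real (expectation (\<lambda>\<omega>. Y (op_powr c ?E u) \<omega> * Y (op_powr c ?E v) \<omega>)) =
        cov (op_powr c ?E u) (op_powr c ?E v)"
      using maps[OF c] u v by (intro expectation_product) auto
    also have "\<dots> = of_real (c\<^sup>2) * cov u v"
      unfolding op using spectral_cov_diagonal_scaling[OF d meas density u v] by (simp only: scale)
    also have "\<dots> = complex_of_real (c\<^sup>2 * expectation (\<lambda>\<omega>. Y u \<omega> * Y v \<omega>))"
      by (simp only: of_real_mult expectation_product[OF u v])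
    also have "c\<^sup>2 * expectation (\<lambda>\<omega>. Y u \<omega> * Y v \<omega>) = expectation (\<lambda>\<omega>. c * Y u \<omega> * (c * Y v \<omega>))"
      by (simp add: power2_eq_square mult_ac flip: integral_mult_right_zero)
    finally show "expectation (\<lambda>\<omega>. Y (op_powr c ?E u) \<omega> * Y (op_powr c ?E v) \<omega>) =
        expectation (\<lambda>\<omega>. c * Y u \<omega> * (c * Y v \<omega>))"
      by (simp only: of_real_eq_iff)
  qed
  show ?thesis
    unfolding operator_scaling_def using eigen maps law by (auto intro: matrix_vector_mul_linear)
qed

text \<open>In dimension one \<open>m < alpha_bar \<alpha>\<close> reads \<open>m * \<alpha> k < 1\<close>, so the Hurst index is below \<open>1\<close>. The
  constant \<open>K\<close> is positive because \<open>2 * K\<close> is the variance of \<open>Y 1\<close>, and \<open>c\<close> normalises this variance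
  to \<open>1\<close>.\<close>

lemma fractional_brownian_up_to_constant:
  assumes "CARD('n) = 1"
  shows "\<exists>c. c \<noteq> 0 \<and> fractional_brownian_motion M ((1 + m * \<alpha> k) / 2) (\<lambda>u \<omega>. c * Y (vec u) \<omega>)"
proof -
  have UNIV: "UNIV = {k}"
    using assms by (metis UNIV_I card_1_singletonE singletonD)
  let ?s = "m * \<alpha> k"
  have s: "0 < ?s" "?s < 1"
    using m_less m_pos \<alpha>_pos[of k] by (simp_all add: alpha_bar_def UNIV field_simps)
  define K where "K = C / (2 * pi) * (LBINT s:{0..min 1 1}. exp (- \<theta> * s)) * cosine_integral ?s 1"
  have orth: "vec u \<in> (orthant :: (real^'n) set)" if "0 \<le> u" for u
    using that by (simp add: orthant_def)
  have E: "expectation (\<lambda>\<omega>. Y (vec u) \<omega> * Y (vec v) \<omega>) =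
      K * (u powr (1 + ?s) + v powr (1 + ?s) - \<bar>u - v\<bar> powr (1 + ?s))" if "0 \<le> u" "0 \<le> v" for u v
  proof -
    have "expectation (\<lambda>\<omega>. Y (vec u) \<omega> * Y (vec v) \<omega>) = Re (cov (vec u) (vec v))"
      using expectation_product[OF orth orth] that by (metis Re_complex_of_real)
    then show ?thesis
      unfolding K_def using spectral_cov_dimension_one[where \<alpha>=\<alpha> and k=k, OF UNIV m_pos \<alpha>_pos[of k] s(2) that] by simp
  qed
  have K: "0 < K"
    using unit_cube_variance_pos E[of 1 1] by simp
  define c where "c = 1 / sqrt (2 * K)"
  have c: "c \<noteq> 0" "c\<^sup>2 = 1 / (2 * K)"
    using K by (simp_all add: c_def power_divide)
  have "fractional_brownian_motion M ((1 + ?s) / 2) (\<lambda>u \<omega>. c * Y (vec u) \<omega>)"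
    unfolding fractional_brownian_motion_def
  proof (intro conjI allI impI)
    have "inj_on (vec :: real \<Rightarrow> real^'n) {0..}"
      by (auto simp: inj_on_def vec_eq_iff)
    moreover have "(vec :: real \<Rightarrow> real^'n) ` {0..} \<subseteq> orthant"
      using orth by auto
    ultimately show "centered_gaussian_field M {0..} (\<lambda>u \<omega>. c * Y (vec u) \<omega>)"
      by (rule centered_gaussian_field_rescale_reindex[OF gaussian])
    fix u v :: real assume uv: "0 \<le> u" "0 \<le> v"
    have exponent: "2 * ((1 + ?s) / 2) = 1 + ?s" by simp
    have "expectation (\<lambda>\<omega>. c * Y (vec u) \<omega> * (c * Y (vec v) \<omega>)) = c\<^sup>2 * expectation (\<lambda>\<omega>. Y (vec u) \<omega> * Y (vec v) \<omega>)"
      by (simp add: power2_eq_square mult_ac flip: integral_mult_right_zero)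
    then show "expectation (\<lambda>\<omega>. c * Y (vec u) \<omega> * (c * Y (vec v) \<omega>)) =
        (u powr (2 * ((1 + ?s) / 2)) + v powr (2 * ((1 + ?s) / 2)) - \<bar>u - v\<bar> powr (2 * ((1 + ?s) / 2))) / 2"
      unfolding E[OF uv] c(2) exponent using K by simp
  qed (use s in simp_all)
  with c show ?thesis by blast
qed

end

theorem proposition2p1:
  fixes M :: "'w measure"
    and \<gamma> \<theta> :: real
    and \<alpha> :: "'n::finite \<Rightarrow> real"
    and Y\<^sub>1 Y\<^sub>2 :: "real^'n \<Rightarrow> 'w \<Rightarrow> real"
  assumes "prob_space M"
    and "\<gamma> > 0" and "\<theta> \<ge> 0"
    and "\<And>k. 0 < \<alpha> k \<and> \<alpha> k \<le> 2"
    and "alpha_bar \<alpha> > 2"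
    and "occupation_field M (\<lambda>z. 2 / stable_symbol \<alpha> z) \<theta> Y\<^sub>1"
    and "occupation_field M (\<lambda>z. \<gamma> / (stable_symbol \<alpha> z)\<^sup>2) \<theta> Y\<^sub>2"
    and "independent_fields M orthant Y\<^sub>1 Y\<^sub>2"
  shows "(CARD('n) = 1 \<longrightarrow>
            (\<forall>k. (\<exists>c. c \<noteq> 0 \<and> fractional_brownian_motion M ((1 + \<alpha> k) / 2) (\<lambda>u \<omega>. c * Y\<^sub>1 (vec u) \<omega>)) \<and>
                 (\<exists>c. c \<noteq> 0 \<and> fractional_brownian_motion M ((1 + 2 * \<alpha> k) / 2) (\<lambda>u \<omega>. c * Y\<^sub>2 (vec u) \<omega>)))) \<and>
         (CARD('n) \<ge> 2 \<longrightarrow>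
            centered_gaussian_field M orthant Y\<^sub>1 \<and>
            operator_scaling M orthant ((*v) ((2 / (1 + alpha_bar \<alpha>)) *\<^sub>R diag_matrix (\<lambda>k. 1 / \<alpha> k))) Y\<^sub>1 \<and>
            \<not> stationary_increments M orthant Y\<^sub>1 \<and>
            centered_gaussian_field M orthant Y\<^sub>2 \<and>
            operator_scaling M orthant ((*v) ((2 / (2 + alpha_bar \<alpha>)) *\<^sub>R diag_matrix (\<lambda>k. 1 / \<alpha> k))) Y\<^sub>2 \<and>
            \<not> stationary_increments M orthant Y\<^sub>2)"
proof -
  interpret Y1: power_spectrum_field M Y\<^sub>1 \<alpha> 2 \<theta> 1
    using assms by (simp add: power_spectrum_field_def power_spectrum_field_axioms_def)
  interpret Y2: power_spectrum_field M Y\<^sub>2 \<alpha> \<gamma> \<theta> 2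
    using assms by (simp add: power_spectrum_field_def power_spectrum_field_axioms_def)
  show ?thesis
    using Y1.fractional_brownian_up_to_constant Y1.gaussian Y1.operator_scaling_inverse_indices Y1.not_stationary_increments
      Y2.fractional_brownian_up_to_constant Y2.gaussian Y2.operator_scaling_inverse_indices Y2.not_stationary_increments
    by simp
qed

end
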